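(* Let $\alpha,\beta,k_1,k_2$ be integers with $0\le k_1\le k_2$, $k_2\ge 3$, $\alpha\ge 0$, $\beta\ge 1$, and let $p,p_1,p_2$ be odd primes. Suppose $[-k_1,\,k_2]^*$ splits the cyclic group $\mathbb{Z}_m$, the splitting is purely singular, and $m=2^{\alpha}p^{\beta}$ or $m=2^{\alpha}p_1p_2$. If $k_1\ge 1$, then $m=k_1+k_2+1$; if $k_1=0$, then $m=k_2+1$ or $m=2k_2+1$.
   Context: For integers $a\le b$, $[a,b]^*=\{a,\dots,b\}\setminus\{0\}$. A set of integers $M$ splits $\mathbb{Z}_m$ with splitter set $S\subseteq\mathbb{Z}_m$ if every nonzero $g\in\mathbb{Z}_m$ has a unique representation $g=ms$ (product mod $m$) with $m\in M$, $s\in S$, while $0$ has no such representation. The splitting is purely singular if for each prime divisor $p$ of $m$ at least one element of $M$ is divisible by $p$. *)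

theory Defs
  imports "HOL-Number_Theory.Number_Theory"
begin

definition interval_star :: "int \<Rightarrow> int \<Rightarrow> int set" where
  "interval_star a b = {a..b} - {0}"

text \<open>
  The group of integers modulo \<open>m\<close> is the set of representatives \<open>{0..m - 1}\<close>, as in
  \<^const>\<open>residue_ring\<close>; this is meant for \<open>m \<ge> 1\<close>. Multipliers are integers and are reduced
  modulo \<open>m\<close> before being multiplied. Uniqueness concerns the pair of multiplier and splitter,
  so two distinct multipliers in \<open>M\<close> that are congruent modulo \<open>m\<close> count as different.
\<close>

definition splits :: "int set \<Rightarrow> int \<Rightarrow> int set \<Rightarrow> bool" where
  "splits M m S \<longleftrightarrow>
     S \<subseteq> carrier (residue_ring m) \<and>
     (\<forall>g \<in> carrier (residue_ring m) - {\<zero>\<^bsub>residue_ring m\<^esub>}.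
        \<exists>!r. r \<in> M \<times> S \<and> g = (fst r mod m) \<otimes>\<^bsub>residue_ring m\<^esub> snd r) \<and>
     (\<nexists>r. r \<in> M \<times> S \<and> \<zero>\<^bsub>residue_ring m\<^esub> = (fst r mod m) \<otimes>\<^bsub>residue_ring m\<^esub> snd r)"

definition purely_singular :: "int set \<Rightarrow> int \<Rightarrow> bool" where
  "purely_singular M m \<longleftrightarrow> (\<forall>q. prime q \<and> q dvd m \<longrightarrow> (\<exists>x \<in> M. q dvd x))"

end

theory Submission
  imports Defs "HOL-Computational_Algebra.Polynomial"
begin

text \<open>
  Let \<open>K = k1 + k2\<close> be the number of multipliers, so \<open>m = card S * K + 1\<close>; pure singularity says that
  all primes dividing \<open>m\<close> are at most \<open>k2\<close>.

  If \<open>m\<close> is even, counting odd elements shows that \<open>D = K + 1\<close> divides \<open>m\<close>. As the multipliers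
  together with \<open>0\<close> represent all residues modulo \<open>D\<close>, the splitters prime to \<open>D\<close> produce exactly the
  non-multiples of \<open>D\<close>. This forces all primes dividing \<open>m\<close> to divide \<open>D\<close> and bounds the prime
  powers in \<open>m\<close> by \<open>k2\<close>; so \<open>m < D\<^sup>2\<close>, whereas \<open>m div D \<equiv> 1\<close> modulo \<open>K\<close> makes \<open>m = D\<close> the only
  possibility.

  If \<open>m\<close> is odd and all splitters are units, then \<open>card S < k2\<close> and \<open>m < (k2 + 1)\<^sup>2\<close>. By the pigeonhole
  principle any two splitters satisfy a relation \<open>a * s + b * t \<equiv> 0\<close> with small positive coefficients.
  For fixed \<open>s\<close> the least \<open>a\<close> belonging to each of the other splitters are distinct and exhaust an
  interval, which leaves no room for an odd number just above it, unless \<open>card S \<le> 2\<close>.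

  For \<open>m = p * q\<close> the splitters are units because their orders exceed \<open>K\<close>. For \<open>m = p ^ b\<close> a count by
  \<open>p\<close>-adic valuation shows that otherwise the unit splitters are a common factor in factorizations
  of two consecutive unit groups modulo powers of \<open>p\<close>. In the group rings over the field with
  \<open>p\<close> elements this makes the number of \<open>y\<close> in the second cofactor with \<open>y ^ (p - 1) \<equiv> 1\<close> divisible by \<open>p\<close>,
  while it lies between \<open>1\<close> and \<open>p - 1\<close>.
\<close>

section \<open>Counting residues\<close>

lemma dvd_less_imp_zero:
  fixes d x :: int
  assumes "d dvd x" "0 \<le> x" "x < d"
  shows "x = 0"
  using assms zdvd_imp_le[of d x] by (cases "x = 0") auto

lemma card_periodic_shift:
  fixes d a :: int
  assumes per: "\<And>g h. [g = h] (mod d) \<Longrightarrow> P g = P h"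
  shows "card {g \<in> {a..<a + d}. P g} = card {g \<in> {0..<d}. P g}"
proof (rule bij_betw_same_card[of "\<lambda>g. g mod d"], rule bij_betw_byWitness[where f' = "\<lambda>g. a + (g - a) mod d"])
  have P_mod: "P (g mod d) = P g" for g
    by (rule per) (simp add: cong_def)
  have P_shift: "P (a + (g - a) mod d) = P g" for g
    by (rule per) (simp add: cong_def mod_add_right_eq)
  show "\<forall>g\<in>{g \<in> {a..<a + d}. P g}. a + (g mod d - a) mod d = g"
    by (auto simp: mod_diff_left_eq)
  show "\<forall>g\<in>{g \<in> {0..<d}. P g}. (a + (g - a) mod d) mod d = g"
    by (auto simp: mod_add_right_eq)
  show "(\<lambda>g. g mod d) ` {g \<in> {a..<a + d}. P g} \<subseteq> {g \<in> {0..<d}. P g}"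
    by (auto simp: P_mod)
  show "(\<lambda>g. a + (g - a) mod d) ` {g \<in> {0..<d}. P g} \<subseteq> {g \<in> {a..<a + d}. P g}"
    by (auto simp: P_shift)
qed

lemma card_periodic_mult:
  fixes d :: int and e :: nat
  assumes per: "\<And>g h. [g = h] (mod d) \<Longrightarrow> P g = P h" and d: "0 \<le> d"
  shows "card {g \<in> {0..<int e * d}. P g} = e * card {g \<in> {0..<d}. P g}"
proof (induction e)
  case (Suc e)
  have split: "{g \<in> {0..<int (Suc e) * d}. P g} =
      {g \<in> {0..<int e * d}. P g} \<union> {g \<in> {int e * d..<int e * d + d}. P g}"
  proof -
    have "{0..<int (Suc e) * d} = {0..<int e * d} \<union> {int e * d..<int e * d + d}"
      using d by (subst ivl_disj_un) (auto simp: algebra_simps)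
    thus ?thesis by blast
  qed
  have "card {g \<in> {0..<int (Suc e) * d}. P g} =
      card {g \<in> {0..<int e * d}. P g} + card {g \<in> {int e * d..<int e * d + d}. P g}"
    unfolding split by (rule card_Un_disjoint) (auto intro: finite_subset[of _ "{_..<_}"])
  thus ?case
    using Suc.IH card_periodic_shift[of d P "int e * d", OF per] by simp
qed simp

lemma card_multiples:
  fixes d m :: int
  assumes "0 < d" "d dvd m" "0 \<le> m"
  shows "int (card {g \<in> {0..<m}. d dvd g}) = m div d"
proof -
  define e where "e = nat (m div d)"
  have m: "m = int e * d" using assms by (simp add: e_def pos_imp_zdiv_nonneg_iff)
  have 1: "{g \<in> {0..<d}. d dvd g} = {0}"
    using assms by (auto dest: zdvd_imp_le)
  have "card {g \<in> {0..<int e * d}. d dvd g} = e * card {g \<in> {0..<d}. d dvd g}"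
    by (rule card_periodic_mult) (use assms in \<open>auto simp: cong_dvd_iff cong_sym_eq\<close>)
  thus ?thesis using 1 m assms by simp
qed

lemma card_filter_split:
  assumes "finite A"
  shows "card {x \<in> A. P x} = card {x \<in> A. Q x \<and> P x} + card {x \<in> A. P x \<and> \<not> Q x}"
proof -
  have "card ({x \<in> A. Q x \<and> P x} \<union> {x \<in> A. P x \<and> \<not> Q x}) =
      card {x \<in> A. Q x \<and> P x} + card {x \<in> A. P x \<and> \<not> Q x}"
    by (rule card_Un_disjoint) (use assms in auto)
  moreover have "{x \<in> A. Q x \<and> P x} \<union> {x \<in> A. P x \<and> \<not> Q x} = {x \<in> A. P x}" by auto
  ultimately show ?thesis by simp
qed

lemma card_nonmultiples:
  fixes d m :: int
  assumes "0 < d" "d dvd m" "0 \<le> m"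
  shows "int (card {g \<in> {0..<m}. \<not> d dvd g}) = m - m div d"
proof -
  have "{g \<in> {0..<m}. True} = {0..<m}" by auto
  hence "int (card {0..<m}) = int (card {g \<in> {0..<m}. d dvd g}) + int (card {g \<in> {0..<m}. \<not> d dvd g})"
    using card_filter_split[of "{0..<m}" "\<lambda>_. True" "\<lambda>g. d dvd g"] by simp
  thus ?thesis using card_multiples[OF assms] assms by simp
qed

lemma card_multiples_image:
  fixes q m :: int
  assumes "0 < q" "q dvd m"
  shows "card {g \<in> {0..<m}. q dvd g \<and> P g} = card {g \<in> {0..<m div q}. P (q * g)}"
proof -
  from assms(2) obtain e where m: "m = q * e" by blast
  have "{g \<in> {0..<m}. q dvd g \<and> P g} = (*) q ` {g \<in> {0..<m div q}. P (q * g)}"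
    using assms(1) by (auto simp: m image_iff elim!: dvdE) (auto simp: zero_le_mult_iff)
  thus ?thesis using assms(1) by (simp add: card_image inj_on_def)
qed

lemma coprime_cong_int:
  fixes g h d m :: int
  assumes "[g = h] (mod m)" "d dvd m"
  shows "coprime g d \<longleftrightarrow> coprime h d"
  using cong_imp_coprime[OF cong_dvd_modulus[OF assms]] cong_imp_coprime[OF cong_sym[OF cong_dvd_modulus[OF assms]]]
  by blast

lemma dvd_cong_int:
  fixes g h d m :: int
  assumes "[g = h] (mod m)" "d dvd m"
  shows "d dvd g \<longleftrightarrow> d dvd h"
  using cong_dvd_modulus[OF assms] by (simp add: cong_dvd_iff)

section \<open>Splittings by intervals\<close>

text \<open>The ring operations of \<open>splits\<close> become integer congruences, so that sizes
  and valuations of representatives can be used directly.\<close>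

locale interval_splitting =
  fixes k1 k2 m :: int and M S :: "int set"
  assumes k1_nonneg: "0 \<le> k1" and k1_le_k2: "k1 \<le> k2" and k2_ge: "3 \<le> k2"
    and m_gt_1: "1 < m"
    and M_eq: "M = interval_star (- k1) k2"
    and S_sub: "S \<subseteq> {0..<m}"
    and cover: "\<And>g. \<not> m dvd g \<Longrightarrow> \<exists>x\<in>M. \<exists>s\<in>S. [x * s = g] (mod m)"
    and nonzero: "\<And>x s. x \<in> M \<Longrightarrow> s \<in> S \<Longrightarrow> \<not> m dvd x * s"
    and unique: "\<And>x s x' s'. x \<in> M \<Longrightarrow> s \<in> S \<Longrightarrow> x' \<in> M \<Longrightarrow> s' \<in> S \<Longrightarrow>
      [x * s = x' * s'] (mod m) \<Longrightarrow> x = x' \<and> s = s'"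

lemma interval_splittingI:
  assumes "0 \<le> k1" "k1 \<le> k2" "3 \<le> k2" "1 < m"
    and splits: "splits (interval_star (- k1) k2) m S"
  shows "interval_splitting k1 k2 m (interval_star (- k1) k2) S"
proof
  let ?M = "interval_star (- k1) k2"
  have carrier: "carrier (residue_ring m) = {0..<m}"
    by (auto simp: residue_ring_def)
  have mult: "x mod m \<otimes>\<^bsub>residue_ring m\<^esub> s = (x * s) mod m" for x s
    by (simp add: residue_ring_def mod_mult_left_eq)
  have zero: "\<zero>\<^bsub>residue_ring m\<^esub> = 0"
    by (simp add: residue_ring_def)
  note sp = splits[unfolded splits_def carrier mult zero]
  show "S \<subseteq> {0..<m}" using sp by blast
  show nz: "\<not> m dvd x * s" if "x \<in> ?M" "s \<in> S" for x s
    using sp that by (metis SigmaI fst_conv snd_conv dvd_imp_mod_0)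
  have ex1: "\<exists>!r. r \<in> ?M \<times> S \<and> g mod m = (fst r * snd r) mod m" if "\<not> m dvd g" for g
  proof -
    have "g mod m \<in> {0..<m} - {0}"
      using that assms by (auto simp: dvd_eq_mod_eq_0)
    thus ?thesis using sp by blast
  qed
  show "\<exists>x\<in>?M. \<exists>s\<in>S. [x * s = g] (mod m)" if "\<not> m dvd g" for g
    using ex1[OF that] unfolding cong_def by (metis mem_Times_iff)
  show "x = x' \<and> s = s'"
    if "x \<in> ?M" "s \<in> S" "x' \<in> ?M" "s' \<in> S" "[x * s = x' * s'] (mod m)" for x s x' s'
    using ex1[OF nz[OF that(1,2)]] that unfolding cong_def
    by (metis (no_types, lifting) SigmaI fst_conv snd_conv)
qed (use assms in auto)

context interval_splitting
begin

lemma M_iff: "x \<in> M \<longleftrightarrow> - k1 \<le> x \<and> x \<le> k2 \<and> x \<noteq> 0"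
  by (auto simp: M_eq interval_star_def)

lemma finite_M [simp]: "finite M"
  by (simp add: M_eq interval_star_def)

lemma finite_S [simp]: "finite S"
  using S_sub finite_subset by blast

text \<open>The main counting device: each residue with \<open>P\<close> is nonzero and hence a
  product in exactly one way.\<close>

lemma card_residues:
  assumes per: "\<And>g h. [g = h] (mod m) \<Longrightarrow> P g = P h" and "\<not> P 0"
  shows "card {g \<in> {0..<m}. P g} = card {r \<in> M \<times> S. P (fst r * snd r)}"
proof -
  have P_mod: "P (g mod m) = P g" for g
    by (rule per) (simp add: cong_def)
  have "bij_betw (\<lambda>r. (fst r * snd r) mod m) {r \<in> M \<times> S. P (fst r * snd r)} {g \<in> {0..<m}. P g}"
    unfolding bij_betw_def
  proof
    show "inj_on (\<lambda>r. (fst r * snd r) mod m) {r \<in> M \<times> S. P (fst r * snd r)}"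
      using unique by (fastforce simp: inj_on_def cong_def)
    show "(\<lambda>r. fst r * snd r mod m) ` {r \<in> M \<times> S. P (fst r * snd r)} = {g \<in> {0..<m}. P g}"
    proof (intro equalityI subsetI)
      fix g assume g: "g \<in> {g \<in> {0..<m}. P g}"
      hence "\<not> m dvd g" using assms(2) dvd_less_imp_zero[of m g] by auto
      then obtain x s where xs: "x \<in> M" "s \<in> S" "[x * s = g] (mod m)"
        using cover by blast
      have "P (x * s)" using per[OF xs(3)] g by simp
      moreover have "g = x * s mod m" using xs(3) g by (simp add: cong_def)
      ultimately show "g \<in> (\<lambda>r. fst r * snd r mod m) ` {r \<in> M \<times> S. P (fst r * snd r)}"
        using xs by (intro image_eqI[of _ _ "(x, s)"]) auto
    qed (use m_gt_1 in \<open>auto simp: P_mod\<close>)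
  qed
  thus ?thesis by (simp add: bij_betw_same_card)
qed

lemma card_residues_mult:
  assumes per: "\<And>g h. [g = h] (mod m) \<Longrightarrow> P g = P h" and "\<not> P 0"
    and P: "\<And>x s. x \<in> M \<Longrightarrow> s \<in> S \<Longrightarrow> P (x * s) \<longleftrightarrow> Q x \<and> R s"
  shows "card {g \<in> {0..<m}. P g} = card {x \<in> M. Q x} * card {s \<in> S. R s}"
proof -
  have "{r \<in> M \<times> S. P (fst r * snd r)} = {x \<in> M. Q x} \<times> {s \<in> S. R s}"
    using P by auto
  thus ?thesis using card_residues[of P] per assms(2) by (simp add: card_cartesian_product)
qed

lemma card_M: "int (card M) = k1 + k2"
proof -
  have "M = {- k1..k2} - {0}" by (simp add: M_eq interval_star_def)
  thus ?thesis using k1_nonneg k1_le_k2 by (subst \<open>M = _\<close>) (simp add: card_Diff_singleton)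
qed

lemma m_eq: "m = int (card S) * (k1 + k2) + 1"
proof -
  have "card {g \<in> {0..<m}. \<not> m dvd g} = card {x \<in> M. True} * card {s \<in> S. True}"
    by (rule card_residues_mult) (auto simp: nonzero cong_dvd_iff cong_sym_eq)
  moreover have "{g \<in> {0..<m}. \<not> m dvd g} = {0<..<m}"
    using dvd_less_imp_zero[of m] by (force simp: order_less_le)
  ultimately have "int (nat (m - 1)) = int (card M) * int (card S)"
    by simp
  thus ?thesis using m_gt_1 by (simp add: card_M algebra_simps)
qed

text \<open>If \<open>d \<le> k2\<close>, then \<open>d\<close> itself is a multiplier annihilating
  \<open>s\<close>; otherwise \<open>k2\<close> and the negative multiplier \<open>k2 - d\<close>
  have the same product with \<open>s\<close>.\<close>

lemma order_gt:
  assumes "s \<in> S" "0 < d" "m dvd d * s"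
  shows "k1 + k2 < d"
proof (rule ccontr)
  assume *: "\<not> k1 + k2 < d"
  show False
  proof (cases "d \<le> k2")
    case True
    thus False using nonzero[of d s] assms k1_nonneg by (auto simp: M_iff)
  next
    case False
    have "[k2 * s = (k2 - d) * s] (mod m)"
      using assms(3) by (simp add: cong_iff_dvd_diff algebra_simps)
    thus False
      using unique[of k2 s "k2 - d" s] False * assms k2_ge k1_nonneg by (auto simp: M_iff)
  qed
qed

end

section \<open>Relations between two splitters\<close>

context interval_splitting
begin

text \<open>For unit splitters these are the numerators of the fractions \<open>a / b\<close> with
  terms in \<open>{1..k2}\<close> that represent \<open>- t / s\<close> modulo
  \<open>m\<close>.\<close>

definition neg_ratios :: "int \<Rightarrow> int \<Rightarrow> int set" where
  "neg_ratios s t = {a \<in> {1..k2}. \<exists>b\<in>{1..k2}. m dvd a * s + b * t}"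

lemma neg_ratiosI: "a \<in> {1..k2} \<Longrightarrow> b \<in> {1..k2} \<Longrightarrow> m dvd a * s + b * t \<Longrightarrow> a \<in> neg_ratios s t"
  unfolding neg_ratios_def by blast

lemma neg_ratiosE:
  assumes "a \<in> neg_ratios s t"
  obtains b where "1 \<le> a" "a \<le> k2" "1 \<le> b" "b \<le> k2" "m dvd a * s + b * t"
  using assms unfolding neg_ratios_def by auto

lemma neg_ratios_gt_k1:
  assumes "s \<in> S" "t \<in> S" "s \<noteq> t" "a \<in> neg_ratios s t"
  shows "k1 < a"
proof (rule ccontr)
  assume "\<not> k1 < a"
  from assms(4) obtain b where b: "1 \<le> a" "a \<le> k2" "1 \<le> b" "b \<le> k2" "m dvd a * s + b * t"
    by (rule neg_ratiosE)
  have "[b * t = (- a) * s] (mod m)"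
    using b(5) by (simp add: cong_iff_dvd_diff algebra_simps)
  thus False
    using unique[of b t "- a" s] assms b \<open>\<not> k1 < a\<close> k1_nonneg by (auto simp: M_iff)
qed

lemma neg_ratios_disjoint:
  assumes "t \<in> S" "t' \<in> S" "a \<in> neg_ratios s t" "a \<in> neg_ratios s t'"
  shows "t = t'"
proof -
  from assms(3) obtain b where b: "1 \<le> b" "b \<le> k2" "m dvd a * s + b * t"
    by (rule neg_ratiosE)
  from assms(4) obtain b' where b': "1 \<le> b'" "b' \<le> k2" "m dvd a * s + b' * t'"
    by (rule neg_ratiosE)
  have "m dvd (a * s + b * t) - (a * s + b' * t')"
    using b b' by (intro dvd_diff)
  hence "[b * t = b' * t'] (mod m)"
    by (simp add: cong_iff_dvd_diff)
  thus ?thesis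
    using unique[of b t b' t'] assms b b' k1_nonneg by (auto simp: M_iff)
qed

text \<open>The difference of the two relations is again positive: with \<open>b' \<le> b\<close> it
  would be a vanishing product or a coincidence of two products.\<close>

lemma neg_ratios_diff:
  assumes "s \<in> S" "t \<in> S" "s \<noteq> t" "a \<in> neg_ratios s t" "a' \<in> neg_ratios s t" "a < a'"
  shows "a' - a \<in> neg_ratios s t"
proof -
  from assms(4) obtain b where b: "1 \<le> a" "1 \<le> b" "b \<le> k2" "m dvd a * s + b * t"
    by (rule neg_ratiosE)
  from assms(5) obtain b' where b': "a' \<le> k2" "1 \<le> b'" "b' \<le> k2" "m dvd a' * s + b' * t"
    by (rule neg_ratiosE)
  have d: "m dvd (a' - a) * s + (b' - b) * t"
    using dvd_diff[OF b'(4) b(4)] by (simp add: algebra_simps)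
  have "b < b'"
  proof (rule ccontr)
    assume "\<not> b < b'"
    hence "b' = b \<or> b' < b" by auto
    thus False
    proof
      assume "b' = b"
      thus False using d nonzero[of "a' - a" s] assms b b' k1_nonneg by (auto simp: M_iff)
    next
      assume "b' < b"
      have "[(a' - a) * s = (b - b') * t] (mod m)"
        using d by (simp add: cong_iff_dvd_diff algebra_simps)
      thus False
        using unique[of "a' - a" s "b - b'" t] assms b b' \<open>b' < b\<close> k1_nonneg by (auto simp: M_iff)
    qed
  qed
  thus ?thesis using d assms b b' by (intro neg_ratiosI[of _ "b' - b"]) auto
qed

text \<open>The pairs \<open>(i, j)\<close> with \<open>0 \<le> i \<le> B\<close> and \<open>0 \<le> j \<le> k2\<close> outnumber the residues \<open>i * s + j * t\<close>;
  a collision gives a relation whose two coefficients must have the same sign.\<close>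

lemma neg_ratios_small:
  assumes "s \<in> S" "t \<in> S" "s \<noteq> t" and B: "0 \<le> B" "B \<le> k2" "m < (B + 1) * (k2 + 1)"
  shows "\<exists>a \<in> neg_ratios s t. a \<le> B"
proof -
  define f where "f = (\<lambda>r :: int \<times> int. (fst r * s + snd r * t) mod m)"
  have "\<not> inj_on f ({0..B} \<times> {0..k2})"
  proof
    assume "inj_on f ({0..B} \<times> {0..k2})"
    moreover have "f ` ({0..B} \<times> {0..k2}) \<subseteq> {0..<m}"
      using m_gt_1 by (auto simp: f_def)
    ultimately have "card ({0..B} \<times> {0..k2}) \<le> card {0..<m}"
      by (intro card_inj_on_le[of f]) auto
    moreover have "int (card ({0..B} \<times> {0..k2})) = (B + 1) * (k2 + 1)"
      using B by (simp add: card_cartesian_product)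
    moreover have "int (card {0..<m}) = m" using m_gt_1 by simp
    ultimately show False using B(3) by linarith
  qed
  then obtain i j i' j' where ij: "i \<in> {0..B}" "j \<in> {0..k2}" "i' \<in> {0..B}" "j' \<in> {0..k2}"
      "(i, j) \<noteq> (i', j')" "f (i, j) = f (i', j')"
    unfolding inj_on_def by auto
  define a b where "a = i - i'" and "b = j - j'"
  have ab: "\<bar>a\<bar> \<le> B" "\<bar>b\<bar> \<le> k2" "a \<noteq> 0 \<or> b \<noteq> 0"
    using ij by (auto simp: a_def b_def)
  have dvd: "m dvd a * s + b * t"
    using ij(6) unfolding f_def cong_def[symmetric] cong_iff_dvd_diff
    by (simp add: a_def b_def algebra_simps)
  have mixed: False if "0 \<le> a'" "a' \<le> k2" "0 \<le> b'" "b' \<le> k2" "a' \<noteq> 0 \<or> b' \<noteq> 0"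
      "m dvd a' * s - b' * t" for a' b'
  proof -
    have cong: "[a' * s = b' * t] (mod m)"
      using that(6) by (simp add: cong_iff_dvd_diff)
    have "a' = 0 \<or> a' \<in> M" "b' = 0 \<or> b' \<in> M" using that k1_nonneg by (auto simp: M_iff)
    thus False
      using cong that nonzero[of a' s] nonzero[of b' t] unique[of a' s b' t] assms by auto
  qed
  consider "0 < a" "0 < b" | "a < 0" "b < 0" | "0 \<le> a" "b \<le> 0" | "a \<le> 0" "0 \<le> b"
    by linarith
  thus ?thesis
  proof cases
    case 1
    thus ?thesis using ab dvd B by (intro bexI[of _ a] neg_ratiosI[of _ b]) auto
  next
    case 2
    have "m dvd (- a) * s + (- b) * t"
      using dvd by (metis dvd_minus_iff minus_add_distrib mult_minus_left)
    thus ?thesis using ab 2 B by (intro bexI[of _ "- a"] neg_ratiosI[of _ "- b"]) auto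
  next
    case 3
    thus ?thesis using mixed[of a "- b"] ab dvd B by auto
  next
    case 4
    have "m dvd (- a) * s - b * t"
      using dvd by (metis dvd_minus_iff minus_add_distrib mult_minus_left uminus_add_conv_diff add.commute)
    thus ?thesis using mixed[of "- a" b] ab 4 B by auto
  qed
qed

text \<open>The product equal to \<open>- a * s\<close> cannot use \<open>s\<close>, because
  \<open>0 < a + x < m\<close>, nor a negative \<open>x\<close>, because then \<open>a * s\<close>
  and \<open>(- x) * t\<close> would coincide.\<close>

lemma neg_ratios_cover:
  assumes "s \<in> S" "coprime s m" "2 * k2 < m" "k1 < a" "a \<le> k2"
  shows "\<exists>t \<in> S - {s}. a \<in> neg_ratios s t"
proof -
  have "\<not> m dvd - a * s"
    using nonzero[of a s] assms k1_nonneg by (auto simp: M_iff)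
  then obtain x t where xt: "x \<in> M" "t \<in> S" "[x * t = - a * s] (mod m)"
    using cover by blast
  have dvd: "m dvd a * s + x * t"
    using xt(3) by (simp add: cong_iff_dvd_diff algebra_simps)
  have "t \<noteq> s"
  proof
    assume "t = s"
    hence "m dvd (a + x) * s" using dvd by (simp add: algebra_simps)
    hence "m dvd a + x"
      using assms(2) by (simp add: coprime_commute coprime_dvd_mult_left_iff)
    thus False using xt(1) assms zdvd_imp_le[of m "a + x"] by (auto simp: M_iff)
  qed
  have "0 < x"
  proof (rule ccontr)
    assume "\<not> 0 < x"
    hence "- x \<in> M" using xt(1) k1_le_k2 k1_nonneg by (auto simp: M_iff)
    moreover have "[a * s = (- x) * t] (mod m)"
      using dvd by (simp add: cong_iff_dvd_diff)
    ultimately show False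
      using unique[of a s "- x" t] xt assms \<open>t \<noteq> s\<close> k1_nonneg by (auto simp: M_iff)
  qed
  thus ?thesis
    using xt \<open>t \<noteq> s\<close> dvd assms k1_nonneg by (intro bexI[of _ t] neg_ratiosI[of _ x]) (auto simp: M_iff)
qed

theorem card_splitter_le_if_coprime:
  fixes n :: int
  defines "n \<equiv> int (card S)"
  assumes cop: "\<And>s. s \<in> S \<Longrightarrow> coprime s m"
    and large: "m < (k2 + 1)\<^sup>2" and n_le: "n + 1 \<le> k2" and n_odd: "odd n \<Longrightarrow> n + 2 \<le> k2"
  shows "n \<le> 1 \<or> n = 2 \<and> k1 = 0"
proof (rule ccontr)
  assume contra: "\<not> (n \<le> 1 \<or> n = 2 \<and> k1 = 0)"
  hence n2: "2 \<le> n" by auto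
  hence "S \<noteq> {}" by (auto simp: n_def)
  then obtain s where s: "s \<in> S" by blast
  have m: "m = n * (k1 + k2) + 1" by (simp add: m_eq n_def)
  have "2 * (k1 + k2) \<le> n * (k1 + k2)"
    using n2 k1_nonneg k2_ge by (intro mult_right_mono) auto
  hence "2 * (k1 + k2) < m" using m by simp
  hence m_gt: "2 * k2 < m" using k1_nonneg by (smt (verit, best))
  \<comment> \<open>The smallest bound for which the pigeonhole argument of
    \<open>neg_ratios_small\<close> works.\<close>
  define B where "B = m div (k2 + 1)"
  have B_mod: "B * (k2 + 1) + m mod (k2 + 1) = m" "0 \<le> m mod (k2 + 1)" "m mod (k2 + 1) < k2 + 1"
    using k2_ge pos_mod_bound[of "k2 + 1" m] by (simp_all add: B_def div_mult_mod_eq del: pos_mod_bound)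
  have B_mult: "B * (k2 + 1) \<le> m"
    using B_mod by linarith
  have "B * (k2 + 1) + m mod (k2 + 1) < B * (k2 + 1) + (k2 + 1)"
    using B_mod(3) by (rule add_strict_left_mono)
  hence B_lt: "m < (B + 1) * (k2 + 1)"
    unfolding B_mod(1) by (simp only: distrib_right mult_1)
  have B0: "0 \<le> B" using k2_ge m_gt_1 by (simp add: B_def pos_imp_zdiv_nonneg_iff)
  have Bk2: "B \<le> k2"
  proof (rule ccontr)
    assume "\<not> B \<le> k2"
    hence "(k2 + 1) * (k2 + 1) \<le> B * (k2 + 1)" using k2_ge by (intro mult_right_mono) auto
    thus False using large B_mult by (simp add: power2_eq_square)
  qed
  define \<mu> where "\<mu> = (\<lambda>t. Min (neg_ratios s t))"
  have fin: "finite (neg_ratios s t)" for t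
    by (rule finite_subset[of _ "{1..k2}"]) (auto simp: neg_ratios_def)
  have \<mu>: "\<mu> t \<in> neg_ratios s t" "k1 < \<mu> t" "\<mu> t \<le> B" if t: "t \<in> S - {s}" for t
  proof -
    obtain a where a: "a \<in> neg_ratios s t" "a \<le> B"
      using neg_ratios_small[of s t B] s t B0 Bk2 B_lt by auto
    show "\<mu> t \<in> neg_ratios s t" unfolding \<mu>_def using a fin by (intro Min_in) auto
    thus "k1 < \<mu> t" using neg_ratios_gt_k1[of s t] s t by auto
    have "\<mu> t \<le> a" unfolding \<mu>_def using a fin by (intro Min_le) auto
    thus "\<mu> t \<le> B" using a by linarith
  qed
  have inj: "inj_on \<mu> (S - {s})"
    using \<mu>(1) neg_ratios_disjoint by (intro inj_onI) (metis DiffD1)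
  have sub: "\<mu> ` (S - {s}) \<subseteq> {k1 + 1..B}"
    using \<mu> by force
  have card_S: "int (card (S - {s})) = n - 1"
    using s n2 by (simp add: n_def card_Diff_singleton)
  have "card (S - {s}) \<le> card {k1 + 1..B}"
    using inj sub by (intro card_inj_on_le) auto
  \<comment> \<open>The \<open>n - 1\<close> distinct minima occupy \<open>B - k1\<close> places.
    Compared with \<open>B * (k2 + 1) \<le> m\<close>, this leaves only \<open>k1 \<le> 1\<close>
    and then \<open>B = n - 1 + k1\<close>.\<close>
  hence nB: "n - 1 \<le> B - k1"
    using card_S n2 by simp
  have "(n - 1 + k1) * (k2 + 1) \<le> B * (k2 + 1)"
    using nB k2_ge by (intro mult_right_mono) auto
  hence prod: "(k1 - 1) * (k2 + 1 - n) \<le> 1"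
    using B_mult m by (simp add: algebra_simps)
  have "k1 \<le> 1"
  proof (rule ccontr)
    assume "\<not> k1 \<le> 1"
    hence "1 * 2 \<le> (k1 - 1) * (k2 + 1 - n)"
      using n_le by (intro mult_mono) auto
    thus False using prod by simp
  qed
  hence k1: "k1 = 0 \<or> k1 = 1" using k1_nonneg by linarith
  have "B * (k2 + 1) < (n + k1) * (k2 + 1)"
    using B_mult m k1 n2 n_le by (auto simp: algebra_simps)
  hence "B < n + k1" using k2_ge by (simp add: mult_less_cancel_right)
  hence B: "B = n - 1 + k1" using nB by simp
  have range: "\<mu> ` (S - {s}) = {k1 + 1..B}"
    using sub inj card_S n2 B by (intro card_subset_eq) (auto simp: card_image)
  \<comment> \<open>The minima exhaust the interval and the sets for distinct \<open>t\<close> are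
    disjoint, so up to \<open>B\<close> each set contains only its minimum.\<close>
  have unique_index: "\<mu> t = a" if a: "t \<in> S - {s}" "a \<in> neg_ratios s t" "k1 < a" "a \<le> B" for t a
  proof -
    obtain t' where t': "t' \<in> S - {s}" "\<mu> t' = a"
    proof -
      have "a \<in> \<mu> ` (S - {s})" unfolding range using a by auto
      thus thesis using that by blast
    qed
    hence "t' = t"
      using \<mu>(1)[of t'] neg_ratios_disjoint[of t' t a s] a by auto
    thus ?thesis using t' by simp
  qed
  \<comment> \<open>The least odd number above \<open>B\<close>, which is \<open>B + 1\<close> or
    \<open>B + 2\<close>. It stays within \<open>k2\<close> thanks to \<open>n + 2 \<le> k2\<close>
    for odd \<open>n\<close>.\<close>
  define w where "w = (if odd (n + k1) then n + k1 else n + k1 + 1)"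
  have w: "odd w" "B < w" "w \<le> k2" "w \<le> n + k1 + 1"
    using k1 n_le n_odd B by (auto simp: w_def)
  obtain t where t: "t \<in> S - {s}" "w \<in> neg_ratios s t"
    using neg_ratios_cover[of s w] s cop m_gt w B n2 by auto
  have st: "s \<in> S" "t \<in> S" "s \<noteq> t" using s t by auto
  note \<mu>t = \<mu>[OF t(1)]
  have d1: "w - \<mu> t \<in> neg_ratios s t"
    using neg_ratios_diff[OF st \<mu>t(1) t(2)] \<mu>t w by linarith
  \<comment> \<open>If \<open>w - \<mu> t\<close> is at most \<open>B\<close>, it is the minimum
    itself and \<open>w\<close> is even. Otherwise \<open>\<mu> t = 1\<close> and
    \<open>k1 = 0\<close>; subtracting once more gives \<open>n - 1 = \<mu> t\<close>, so
    \<open>n = 2\<close>.\<close>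
  show False
  proof (cases "w - \<mu> t \<le> B")
    case True
    hence "\<mu> t = w - \<mu> t"
      using unique_index t d1 neg_ratios_gt_k1[OF st d1] by blast
    thus False using w(1) by presburger
  next
    case False
    hence *: "\<mu> t = 1" "k1 = 0" "w = n + 1" using w B \<mu>t(2) k1_nonneg by linarith+
    have "n - 1 \<in> neg_ratios s t"
      using neg_ratios_diff[OF st \<mu>t(1) d1] * n2 by simp
    hence "\<mu> t = n - 1" using unique_index[of t "n - 1"] t B * n2 by simp
    thus False using * contra by simp
  qed
qed

end

section \<open>Even modulus\<close>

context interval_splitting
begin

text \<open>\<open>M\<close> together with 0 consists of \<open>D\<close> consecutive integers, a
  complete residue system modulo \<open>D\<close>.\<close>

definition D :: int where "D = k1 + k2 + 1"

lemma D_ge: "k2 < D" "2 \<le> D"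
  using k1_nonneg k2_ge by (auto simp: D_def)

lemma M_dvd_imp_False:
  assumes "x \<in> M" "x' \<in> insert 0 M" "x \<noteq> x'" "D dvd x - x'"
  shows False
proof -
  have "D dvd \<bar>x - x'\<bar>" using assms(4) by simp
  moreover have "\<bar>x - x'\<bar> < D" using assms k1_nonneg k2_ge by (auto simp: M_iff D_def)
  ultimately show False using dvd_less_imp_zero[of D "\<bar>x - x'\<bar>"] assms(3) by simp
qed

lemma card_M_periodic:
  assumes "\<And>g h. [g = h] (mod D) \<Longrightarrow> P g = P h" and "\<not> P 0"
  shows "card {x \<in> M. P x} = card {g \<in> {0..<D}. P g}"
proof -
  have "{x \<in> M. P x} = {g \<in> {- k1..<- k1 + D}. P g}"
    using assms(2) by (auto simp: M_iff D_def)
  thus ?thesis using card_periodic_shift[of D P "- k1"] assms(1) by simp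
qed

text \<open>Odd residues are the products of odd multipliers and odd splitters. There are
  \<open>m div 2\<close> odd residues and \<open>D div 2\<close> odd multipliers, so the latter
  number divides the former.\<close>

lemma even_imp_D_dvd:
  assumes "even m"
  shows "D dvd m" "even D"
proof -
  have "odd (int (card S) * (k1 + k2))"
    using m_eq assms by (metis even_plus_one_iff)
  thus D: "even D" by (simp add: D_def)
  have "card {g \<in> {0..<m}. odd g} = card {x \<in> M. odd x} * card {s \<in> S. odd s}"
    by (rule card_residues_mult) (use assms in \<open>auto simp: dvd_cong_int\<close>)
  hence "int (card {g \<in> {0..<m}. odd g}) = int (card {x \<in> M. odd x}) * int (card {s \<in> S. odd s})"
    by simp
  moreover have "card {x \<in> M. odd x} = card {g \<in> {0..<D}. odd g}"
    by (rule card_M_periodic) (use D in \<open>auto simp: dvd_cong_int\<close>)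
  ultimately have "m - m div 2 = (D - D div 2) * int (card {s \<in> S. odd s})"
    using card_nonmultiples[of 2 m] card_nonmultiples[of 2 D] assms D D_ge m_gt_1 by simp
  moreover have "m - m div 2 = m div 2" "D - D div 2 = D div 2"
    using assms D by presburger+
  ultimately have "2 * (m div 2) = 2 * (D div 2) * int (card {s \<in> S. odd s})"
    by simp
  thus "D dvd m" using assms D by simp
qed

section \<open>Splitters prime to \<open>D\<close> when \<open>D\<close> divides
  \<open>m\<close>\<close>

context
  fixes E :: nat and S' :: "int set"
  assumes m_E: "m = int E * D"
  defines "S' \<equiv> {s \<in> S. coprime s D}"
begin

lemma D_dvd_m: "D dvd m"
  by (simp add: m_E)

lemma card_coprime_D: "card {x \<in> M. coprime x D} = card {g \<in> {0..<D}. coprime g D}"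
  by (rule card_M_periodic) (use D_ge in \<open>auto simp: coprime_cong_int\<close>)

lemma card_coprime_D_pos: "0 < card {x \<in> M. coprime x D}"
proof -
  have "1 \<in> {x \<in> M. coprime x D}" using k1_nonneg k2_ge by (auto simp: M_iff)
  thus ?thesis by (metis (no_types, lifting) card_gt_0_iff empty_iff finite_M finite_subset mem_Collect_eq subsetI)
qed

text \<open>Residues prime to \<open>D\<close> factor into a multiplier and a splitter prime to
  \<open>D\<close>. They are \<open>E\<close> times as many in \<open>{0..<m}\<close> as in
  \<open>{0..<D}\<close>, and \<open>M\<close> has as many as \<open>{0..<D}\<close>.\<close>

lemma card_S': "card S' = E"
proof -
  have "card {g \<in> {0..<m}. coprime g D} = card {x \<in> M. coprime x D} * card {s \<in> S. coprime s D}"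
    by (rule card_residues_mult) (use D_ge D_dvd_m in \<open>auto simp: coprime_cong_int\<close>)
  moreover have "card {g \<in> {0..<int E * D}. coprime g D} = E * card {g \<in> {0..<D}. coprime g D}"
    by (rule card_periodic_mult) (use D_ge in \<open>auto simp: coprime_cong_int\<close>)
  ultimately have "card {x \<in> M. coprime x D} * card S' = card {x \<in> M. coprime x D} * E"
    using card_coprime_D by (auto simp: m_E S'_def)
  thus ?thesis using card_coprime_D_pos by (metis mult_cancel1 less_numeral_extra(3))
qed

text \<open>The products of \<open>M\<close> with \<open>S'\<close> are distinct and avoid the
  multiples of \<open>D\<close>; their number \<open>(D - 1) * E\<close> is that of all
  non-multiples.\<close>

lemma S'_cover:
  assumes "\<not> D dvd g"
  shows "\<exists>x\<in>M. \<exists>s\<in>S'. [x * s = g] (mod m)"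
proof -
  define f where "f = (\<lambda>r :: int \<times> int. (fst r * snd r) mod m)"
  have inj: "inj_on f (M \<times> S')"
    using unique by (fastforce simp: inj_on_def f_def S'_def cong_def)
  have sub: "f ` (M \<times> S') \<subseteq> {g \<in> {0..<m}. \<not> D dvd g}"
  proof safe
    fix x s assume xs: "x \<in> M" "s \<in> S'"
    show "f (x, s) \<in> {0..<m}" using m_gt_1 by (simp add: f_def)
    assume "D dvd f (x, s)"
    hence "D dvd x * s" using D_dvd_m by (simp add: f_def dvd_mod_iff)
    hence "D dvd x" using xs by (simp add: S'_def coprime_commute coprime_dvd_mult_left_iff)
    thus False using M_dvd_imp_False[of x 0] xs by (auto simp: M_iff)
  qed
  have "int (card {g \<in> {0..<m}. \<not> D dvd g}) = m - m div D"
    by (rule card_nonmultiples) (use D_ge D_dvd_m m_gt_1 in auto)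
  also have "m div D = int E" using D_ge by (simp add: m_E)
  also have "m - int E = int (card (M \<times> S'))"
    by (simp add: card_cartesian_product card_S' card_M m_E D_def algebra_simps)
  finally have "f ` (M \<times> S') = {g \<in> {0..<m}. \<not> D dvd g}"
    using inj by (intro card_subset_eq[OF _ sub]) (auto simp: card_image intro: finite_subset[of _ "{0..<m}"])
  moreover have "g mod m \<in> {g \<in> {0..<m}. \<not> D dvd g}"
    using assms m_gt_1 D_dvd_m by (simp add: dvd_mod_iff)
  ultimately have "g mod m \<in> f ` (M \<times> S')" by blast
  thus ?thesis by (force simp: f_def cong_def)
qed

text \<open>The elements congruent to \<open>D / 2\<close> modulo \<open>D\<close> are the products of \<open>S'\<close> with a single
  multiplier, so \<open>q\<close> divides the fraction \<open>1 / q\<close> of \<open>S'\<close>; then no multiplier prime to \<open>D\<close> can be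
  divisible by \<open>q\<close>, although \<open>q\<close> itself is one.\<close>

lemma prime_dvd_D:
  assumes "even D" and q: "prime q" "q dvd m" "q \<le> k2"
  shows "q dvd D"
proof (rule ccontr)
  assume "\<not> q dvd D"
  hence cop: "coprime q D" using q(1) by (simp add: prime_imp_coprime)
  obtain q' where q': "[q * q' = 1] (mod D)" using cong_solve_coprime_int[OF cop] by blast
  have q0: "0 < q" using q(1) by (simp add: prime_gt_0_int)
  have "q dvd int E" using q(2) cop by (simp add: m_E coprime_dvd_mult_left_iff)
  then obtain F' where F': "int E = q * F'" by blast
  define F where "F = nat F'"
  have F: "int E = q * int F"
    using F' q0 by (simp add: F_def) (metis of_nat_0_le_iff zero_le_mult_iff leD)
  have m_div: "m div q = int F * D" using q0 by (simp add: m_E F)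
  define h where "h = D div 2"
  have h: "D = 2 * h" "0 < h" "\<not> D dvd h"
    using assms(1) D_ge dvd_less_imp_zero[of D h] by (auto simp: h_def)
  \<comment> \<open>The representative of \<open>h\<close> modulo \<open>D\<close> in the window
    from \<open>- k1\<close> to \<open>k2\<close>.\<close>
  define x0 where "x0 = (h + k1) mod D - k1"
  have x0_cong: "[x0 = h] (mod D)"
    by (simp add: x0_def cong_def mod_diff_left_eq)
  have "x0 \<noteq> 0" using dvd_cong_int[OF x0_cong dvd_refl] h(3) by auto
  hence x0: "x0 \<in> M"
    using D_ge pos_mod_bound[of D "h + k1"] by (auto simp: M_iff x0_def D_def)
  have h_mult: "[h * s = h] (mod D)" if "s \<in> S'" for s
  proof -
    have "odd s" using that h(1) by (auto simp: S'_def)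
    then obtain r where "s = 2 * r + 1" by (elim oddE)
    hence "h * s - h = D * r" by (simp add: h(1) algebra_simps)
    thus ?thesis by (simp add: cong_iff_dvd_diff)
  qed
  have x0_eq: "x = x0" if "x \<in> M" "s \<in> S'" "[x * s = h] (mod D)" for x s
  proof -
    have "[x * s = h * s] (mod D)" using that(3) h_mult[OF that(2)] cong_trans cong_sym by blast
    hence "[x = h] (mod D)"
      using that(2) by (simp add: S'_def cong_mult_rcancel coprime_commute)
    hence "[x = x0] (mod D)" using x0_cong cong_trans cong_sym by blast
    thus "x = x0" using M_dvd_imp_False[of x x0] that x0 by (auto simp: cong_iff_dvd_diff)
  qed
  have x0s: "[x0 * s = h] (mod D)" if "s \<in> S'" for s
  proof -
    show ?thesis using cong_trans[OF cong_mult[OF x0_cong cong_refl] h_mult[OF that]] .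
  qed
  \<comment> \<open>\<open>h\<close> itself is a product with multiplier \<open>x0\<close>, so
    \<open>q\<close> would divide \<open>h\<close> and hence \<open>D\<close>.\<close>
  have q_x0: "\<not> q dvd x0"
  proof
    assume "q dvd x0"
    obtain x s where xs: "x \<in> M" "s \<in> S'" "[x * s = h] (mod m)" using S'_cover h(3) by blast
    hence "x = x0" using x0_eq cong_dvd_modulus D_dvd_m by blast
    hence "q dvd h" using xs(3) \<open>q dvd x0\<close> q(2) dvd_cong_int[of "x * s" h m q] by auto
    thus False using \<open>\<not> q dvd D\<close> h(1) by simp
  qed
  have "bij_betw (\<lambda>s. (x0 * s) mod m) {s \<in> S'. q dvd s} {g \<in> {0..<m}. q dvd g \<and> [g = h] (mod D)}"
    unfolding bij_betw_def
  proof
    show "inj_on (\<lambda>s. (x0 * s) mod m) {s \<in> S'. q dvd s}"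
      using unique x0 by (fastforce simp: inj_on_def S'_def cong_def)
    show "(\<lambda>s. (x0 * s) mod m) ` {s \<in> S'. q dvd s} = {g \<in> {0..<m}. q dvd g \<and> [g = h] (mod D)}"
    proof (intro equalityI subsetI)
      fix g assume g: "g \<in> {g \<in> {0..<m}. q dvd g \<and> [g = h] (mod D)}"
      hence "\<not> D dvd g" using h(3) by (auto simp: cong_dvd_iff)
      then obtain x s where xs: "x \<in> M" "s \<in> S'" "[x * s = g] (mod m)" using S'_cover by blast
      hence "[x * s = h] (mod D)"
        using g cong_trans[OF cong_dvd_modulus[OF xs(3) D_dvd_m]] by blast
      hence [simp]: "x = x0" using x0_eq xs by blast
      have "q dvd s" using dvd_cong_int[OF xs(3) q(2)] g q_x0 q(1) prime_dvd_mult_iff by auto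
      moreover have "g = x0 * s mod m" using xs(3) g by (simp add: cong_def)
      ultimately show "g \<in> (\<lambda>s. (x0 * s) mod m) ` {s \<in> S'. q dvd s}" using xs by blast
    next
      fix g assume "g \<in> (\<lambda>s. (x0 * s) mod m) ` {s \<in> S'. q dvd s}"
      then obtain s where s: "s \<in> S'" "q dvd s" "g = (x0 * s) mod m" by blast
      have "[g = x0 * s] (mod D)" using s(3) D_dvd_m by (simp add: cong_def mod_mod_cancel)
      thus "g \<in> {g \<in> {0..<m}. q dvd g \<and> [g = h] (mod D)}"
        using s m_gt_1 q(2) cong_trans[OF _ x0s[OF s(1)]] by (auto simp: dvd_mod_iff)
    qed
  qed
  hence "card {s \<in> S'. q dvd s} = card {g \<in> {0..<m}. q dvd g \<and> [g = h] (mod D)}"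
    by (rule bij_betw_same_card)
  also have "\<dots> = card {g \<in> {0..<int F * D}. [q * g = h] (mod D)}"
    using card_multiples_image[of q m "\<lambda>g. [g = h] (mod D)"] q0 q(2) by (simp add: m_div)
  also have "\<dots> = F * card {g \<in> {0..<D}. [q * g = h] (mod D)}"
  proof (rule card_periodic_mult)
    fix g g' :: int assume "[g = g'] (mod D)"
    hence "[q * g = q * g'] (mod D)" by (rule cong_scalar_left)
    thus "[q * g = h] (mod D) = [q * g' = h] (mod D)" using cong_trans cong_sym by blast
  qed (use D_ge in simp)
  also have "{g \<in> {0..<D}. [q * g = h] (mod D)} = {(q' * h) mod D}"
  proof (intro equalityI subsetI)
    fix g assume "g \<in> {g \<in> {0..<D}. [q * g = h] (mod D)}"
    hence g: "0 \<le> g" "g < D" "[q * g = h] (mod D)" by auto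
    have "[g = (q * q') * g] (mod D)" using cong_scalar_right[OF cong_sym[OF q'], of g] by simp
    also have "(q * q') * g = q' * (q * g)" by simp
    also have "[q' * (q * g) = q' * h] (mod D)" using g(3) by (rule cong_scalar_left)
    finally show "g \<in> {(q' * h) mod D}" using g by (simp add: cong_def)
  next
    fix g assume "g \<in> {(q' * h) mod D}"
    hence g: "g = (q' * h) mod D" by simp
    have "[q * g = (q * q') * h] (mod D)" by (simp add: g cong_def mod_mult_right_eq mult.assoc)
    also have "[(q * q') * h = 1 * h] (mod D)" using q' by (rule cong_scalar_right)
    finally show "g \<in> {g \<in> {0..<D}. [q * g = h] (mod D)}" using g D_ge by simp
  qed
  finally have card_q: "card {s \<in> S'. q dvd s} = F" by simp
  have E_F: "E = nat q * F" using F q0 by (metis nat_int nat_mult_distrib order_less_imp_le)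
  have q2: "2 \<le> nat q" using prime_ge_2_int[OF q(1)] by simp
  have E_pos: "0 < F" using m_E E_F m_gt_1 by (intro gr0I) simp
  have FE: "F < E" using E_F E_pos q2 by simp
  have fin: "finite S'" by (simp add: S'_def)
  have card_S'_q: "card {s \<in> S. coprime s D \<and> \<not> q dvd s} = E - F"
    using card_filter_split[OF fin, of "\<lambda>_. True" "\<lambda>s. q dvd s"] card_q card_S'
    by (simp add: S'_def conj_commute conj_left_commute)
  \<comment> \<open>The residues prime to \<open>D\<close> and not divisible by \<open>q\<close>
    number \<open>(E - F) * \<phi>\<close>. As products they use the \<open>E - F\<close> splitters
    of \<open>S'\<close> not divisible by \<open>q\<close>, so all \<open>\<phi>\<close> multipliers
    prime to \<open>D\<close> must avoid the factor \<open>q\<close>.\<close>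
  define \<phi> where "\<phi> = card {x \<in> M. coprime x D}"
  have "card {g \<in> {0..<m}. coprime g D \<and> \<not> q dvd g} =
      card {x \<in> M. coprime x D \<and> \<not> q dvd x} * card {s \<in> S. coprime s D \<and> \<not> q dvd s}"
  proof (rule card_residues_mult)
    fix g g' :: int assume "[g = g'] (mod m)"
    thus "(coprime g D \<and> \<not> q dvd g) = (coprime g' D \<and> \<not> q dvd g')"
      using coprime_cong_int D_dvd_m dvd_cong_int q(2) by blast
  qed (use q(1) D_ge in \<open>auto simp: prime_dvd_mult_iff\<close>)
  moreover have "card {g \<in> {0..<m}. coprime g D} = E * \<phi>"
    unfolding m_E \<phi>_def card_coprime_D
    by (rule card_periodic_mult) (use D_ge in \<open>auto simp: coprime_cong_int\<close>)
  moreover have "card {g \<in> {0..<m}. q dvd g \<and> coprime g D} = F * \<phi>"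
  proof -
    have "card {g \<in> {0..<m}. q dvd g \<and> coprime g D} = card {g \<in> {0..<int F * D}. coprime (q * g) D}"
      using card_multiples_image[of q m "\<lambda>g. coprime g D"] q0 q(2) by (simp add: m_div)
    also have "\<dots> = card {g \<in> {0..<int F * D}. coprime g D}" using cop by simp
    also have "\<dots> = F * \<phi>" unfolding \<phi>_def card_coprime_D
      by (rule card_periodic_mult) (use D_ge in \<open>auto simp: coprime_cong_int\<close>)
    finally show ?thesis .
  qed
  moreover have "card {g \<in> {0..<m}. coprime g D} = card {g \<in> {0..<m}. q dvd g \<and> coprime g D} +
      card {g \<in> {0..<m}. coprime g D \<and> \<not> q dvd g}"
    by (rule card_filter_split) simp
  ultimately have "\<phi> * (E - F) = card {x \<in> M. coprime x D \<and> \<not> q dvd x} * (E - F)"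
    using card_S'_q by (simp add: algebra_simps diff_mult_distrib)
  hence "card {x \<in> M. coprime x D \<and> \<not> q dvd x} = card {x \<in> M. coprime x D}"
    using FE by (simp add: \<phi>_def)
  hence eq: "{x \<in> M. coprime x D \<and> \<not> q dvd x} = {x \<in> M. coprime x D}"
    by (intro card_subset_eq) auto
  have "q \<in> {x \<in> M. coprime x D}"
    using q q0 cop k1_nonneg by (auto simp: M_iff)
  hence "q \<in> {x \<in> M. coprime x D \<and> \<not> q dvd x}"
    unfolding eq .
  thus False by simp
qed

text \<open>\<open>q ^ e\<close> is a product with a splitter prime to \<open>D\<close>, hence to
  \<open>q\<close>, so the multiplier absorbs the whole power.\<close>

lemma prime_power_le:
  assumes q: "prime q" "q dvd D" "q ^ e dvd m" and "\<not> D dvd q ^ e"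
  shows "q ^ e \<le> k2"
proof -
  obtain x s where xs: "x \<in> M" "s \<in> S'" "[x * s = q ^ e] (mod m)" using S'_cover assms(4) by blast
  have "coprime s (q ^ e)" using xs(2) q(2) coprime_divisors[of s s q D] by (simp add: S'_def)
  moreover have "q ^ e dvd x * s" using dvd_cong_int[OF xs(3) q(3)] by simp
  ultimately have "q ^ e dvd x" by (simp add: coprime_commute coprime_dvd_mult_left_iff)
  hence "q ^ e \<le> \<bar>x\<bar>" using xs(1) dvd_imp_le_int[of x "q ^ e"] by (auto simp: M_iff)
  thus ?thesis using xs(1) k1_le_k2 by (auto simp: M_iff)
qed

text \<open>Both \<open>m\<close> and \<open>D\<close> are 1 modulo \<open>D - 1\<close>, hence so
  is the quotient \<open>E\<close>.\<close>

lemma quotient_eq_1_or_ge: "E = 1 \<or> D \<le> int E"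
proof -
  have "int E * D = int (card S) * (k1 + k2) + 1" using m_eq m_E by simp
  hence "int E - 1 = (int (card S) - int E) * (D - 1)" by (simp add: D_def algebra_simps)
  hence *: "D - 1 dvd int E - 1" by simp
  show ?thesis
  proof (cases "E = 1")
    case False
    have "E \<noteq> 0" using m_E m_gt_1 by (intro notI) simp
    hence "0 < int E - 1" using False by simp
    thus ?thesis using zdvd_imp_le[OF *] by simp
  qed simp
qed

end

text \<open>\<open>E \<ge> D\<close> would give \<open>D * D \<le> m\<close>. But the power of 2 is
  at most \<open>k2\<close>, while the odd part is at most \<open>k2\<close> for a prime power and
  divides \<open>D\<close> for two distinct primes.\<close>

lemma m_eq_D_if_even:
  assumes "even m"
    and small: "\<And>q. prime q \<Longrightarrow> q dvd m \<Longrightarrow> q \<le> k2"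
    and "odd p" "odd p1" "odd p2" "prime p" "prime p1" "prime p2" "0 < \<beta>"
    and form: "m = 2 ^ \<alpha> * p ^ \<beta> \<or> m = 2 ^ \<alpha> * (p1 * p2) \<and> p1 \<noteq> p2"
  shows "m = D"
proof -
  have D: "D dvd m" "even D" using even_imp_D_dvd assms(1) by auto
  define E where "E = nat (m div D)"
  have E: "m = int E * D"
    using D D_ge m_gt_1 by (simp add: E_def pos_imp_zdiv_nonneg_iff)
  have "\<not> D \<le> int E"
  proof
    assume "D \<le> int E"
    hence "D * D \<le> m" using D_ge unfolding E by (intro mult_right_mono) auto
    moreover have "k2 * k2 < D * D"
      using D_ge k2_ge by (intro mult_strict_mono') auto
    ultimately have large: "k2 * k2 < m" "k2 * D < m" using D_ge k2_ge
      by (auto intro: less_le_trans[OF mult_strict_right_mono])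
    have pD: "q dvd D" if "prime q" "q dvd m" for q
      using prime_dvd_D[OF E] D(2) small that by blast
    have pp: "q ^ e \<le> k2" if "prime q" "q ^ e dvd m" "0 < e" "\<not> D dvd q ^ e" for q e
    proof -
      have "q dvd m" using that(2,3) dvd_power dvd_trans by blast
      thus ?thesis using prime_power_le[OF E] pD that by blast
    qed
    have odd_not_dvd: "\<not> q dvd (2::int) ^ e" if "prime q" "odd q" for q e
      using that prime_dvd_power[of q 2 e] primes_dvd_imp_eq[of q 2] by auto
    \<comment> \<open>The odd prime \<open>q\<close> divides \<open>D\<close>, so \<open>D\<close>
      cannot divide a power of 2.\<close>
    have two: "2 ^ \<alpha> \<le> k2" if "2 ^ \<alpha> dvd m" "q dvd m" "prime q" "odd q" for q
    proof (cases "\<alpha> = 0")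
      case False
      have "\<not> D dvd 2 ^ \<alpha>" using pD odd_not_dvd that dvd_trans by blast
      thus ?thesis using pp[of 2 \<alpha>] that False by auto
    qed (use k2_ge in simp)
    from form show False
    proof
      assume m: "m = 2 ^ \<alpha> * p ^ \<beta>"
      have "p dvd m" using \<open>0 < \<beta>\<close> by (simp add: m dvd_power)
      hence a: "2 ^ \<alpha> \<le> k2" using two[of p] m assms by simp
      have "odd (p ^ \<beta>)" using assms by simp
      hence "\<not> D dvd p ^ \<beta>" using D(2) dvd_trans by blast
      hence "p ^ \<beta> \<le> k2" using pp[of p \<beta>] m assms by simp
      hence "m \<le> k2 * k2" unfolding m using a k2_ge \<open>prime p\<close>
        by (intro mult_mono) (auto simp: prime_ge_0_int)
      thus False using large by simp
    next
      assume "m = 2 ^ \<alpha> * (p1 * p2) \<and> p1 \<noteq> p2"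
      hence m: "m = 2 ^ \<alpha> * (p1 * p2)" and "p1 \<noteq> p2" by auto
      have a: "2 ^ \<alpha> \<le> k2" using two[of p1] m assms by simp
      have "coprime p1 p2" using assms \<open>p1 \<noteq> p2\<close> by (simp add: primes_coprime)
      hence "p1 * p2 dvd D" using pD[of p1] pD[of p2] m assms by (intro divides_mult) auto
      hence "p1 * p2 \<le> D" using D_ge by (intro zdvd_imp_le) auto
      hence "m \<le> k2 * D" unfolding m using a k2_ge assms
        by (intro mult_mono) (auto simp: prime_ge_0_int)
      thus False using large by simp
    qed
  qed
  hence "E = 1" using quotient_eq_1_or_ge[OF E] by blast
  thus ?thesis using E by simp
qed

end

section \<open>Integer polynomials modulo a prime and \<open>X ^ N - 1\<close>\<close>

text \<open>Additivity of the Frobenius map modulo \<open>p\<close>, in a general commutative ring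
  so that it applies to polynomials.\<close>

lemma prime_dvd_binomial_remainder:
  fixes x y :: "'a :: comm_ring_1"
  assumes "prime p"
  shows "of_nat p dvd (x + y) ^ p - (x ^ p + y ^ p)"
proof -
  have p: "1 < p" using assms prime_gt_1_nat by blast
  have "(x + y) ^ p = (\<Sum>k\<le>p. of_nat (p choose k) * x ^ k * y ^ (p - k))"
    by (rule binomial_ring)
  also have "{..p} = insert 0 (insert p {0<..<p})" by auto
  also have "(\<Sum>k\<in>insert 0 (insert p {0<..<p}). of_nat (p choose k) * x ^ k * y ^ (p - k)) =
      y ^ p + (x ^ p + (\<Sum>k\<in>{0<..<p}. of_nat (p choose k) * x ^ k * y ^ (p - k)))"
    using p by simp
  finally have "(x + y) ^ p - (x ^ p + y ^ p) =
      (\<Sum>k\<in>{0<..<p}. of_nat (p choose k) * x ^ k * y ^ (p - k))"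
    by simp
  moreover have "of_nat p dvd (of_nat (p choose k) :: 'a)" if "k \<in> {0<..<p}" for k
  proof -
    have "p dvd p choose k" by (rule dvd_choose_prime) (use that assms in auto)
    thus ?thesis by (auto elim: dvdE)
  qed
  ultimately show ?thesis by (auto intro!: dvd_sum dvd_mult2)
qed

lemma dvd_diff_imp_dvd_power_diff:
  fixes x y d :: "'a :: comm_ring_1"
  assumes "d dvd x - y"
  shows "d dvd x ^ n - y ^ n"
  unfolding power_diff_sumr2 using assms by (rule dvd_mult2)

lemma prime_dvd_binomial_remainder_power:
  fixes x y :: "'a :: comm_ring_1"
  assumes "prime p"
  shows "of_nat p dvd (x + y) ^ (p ^ k) - (x ^ (p ^ k) + y ^ (p ^ k))"
proof (induction k)
  case (Suc k)
  let ?q = "p ^ k"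
  have "of_nat p dvd ((x + y) ^ ?q) ^ p - (x ^ ?q + y ^ ?q) ^ p"
    using Suc.IH by (rule dvd_diff_imp_dvd_power_diff)
  moreover have "of_nat p dvd (x ^ ?q + y ^ ?q) ^ p - ((x ^ ?q) ^ p + (y ^ ?q) ^ p)"
    using assms by (rule prime_dvd_binomial_remainder)
  ultimately have "of_nat p dvd (((x + y) ^ ?q) ^ p - (x ^ ?q + y ^ ?q) ^ p) +
      ((x ^ ?q + y ^ ?q) ^ p - ((x ^ ?q) ^ p + (y ^ ?q) ^ p))"
    by (rule dvd_add)
  also have "\<dots> = (x + y) ^ p ^ Suc k - (x ^ p ^ Suc k + y ^ p ^ Suc k)"
    by (simp only: diff_add_cancel add_diff_eq power_mult[symmetric] power_Suc2)
  finally show ?case .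
qed simp

lemma prime_dvd_power_prime_power_diff:
  fixes a :: int
  assumes "prime p"
  shows "int p dvd a ^ (p ^ k) - a"
proof (induction k)
  case (Suc k)
  have fermat: "int p dvd b ^ p - b" for b :: int
  proof (cases "int p dvd b")
    case True
    moreover from this have "int p dvd b ^ p" using prime_gt_0_nat[OF assms] by (metis dvd_power dvd_trans)
    ultimately show ?thesis by (rule dvd_diff[rotated])
  next
    case False
    define c where "c = nat (b mod int p)"
    have c: "[b = int c] (mod int p)"
      using assms by (simp add: c_def cong_def prime_gt_0_nat)
    have "\<not> p dvd c" using False c by (metis cong_dvd_iff int_dvd_int_iff)
    hence "[c ^ (p - 1) = 1] (mod p)" by (rule fermat_theorem[OF assms])
    hence "[int c ^ (p - 1) = 1] (mod int p)" by (simp flip: cong_int_iff)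
    hence "[b ^ (p - 1) = 1] (mod int p)" using cong_pow[OF c] cong_trans by blast
    hence "[b ^ (p - 1) * b = 1 * b] (mod int p)" by (rule cong_scalar_right)
    moreover have "b ^ (p - 1) * b = b ^ p"
      using assms by (metis power_minus_mult prime_gt_0_nat)
    ultimately show ?thesis by (simp add: cong_iff_dvd_diff)
  qed
  have "a ^ p ^ Suc k - a = ((a ^ p ^ k) ^ p - a ^ p ^ k) + (a ^ p ^ k - a)"
    by (simp add: power_mult[symmetric] mult.commute)
  thus ?case using fermat[of "a ^ p ^ k"] Suc.IH by (metis dvd_add)
qed simp

section \<open>The ideal generated by \<open>p\<close> and \<open>X ^ N - 1\<close>\<close>

abbreviation X :: "int poly" where "X \<equiv> [:0, 1:]"

text \<open>For prime \<open>p\<close> and \<open>N > 0\<close> the quotient by this ideal is the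
  group ring of a cyclic group of order \<open>N\<close> over the field with \<open>p\<close>
  elements.\<close>

definition in_ideal :: "nat \<Rightarrow> nat \<Rightarrow> int poly \<Rightarrow> bool" where
  "in_ideal p N f \<longleftrightarrow> (\<exists>u v. f = of_nat p * u + (X ^ N - 1) * v)"

lemma in_ideal_add: "in_ideal p N f \<Longrightarrow> in_ideal p N g \<Longrightarrow> in_ideal p N (f + g)"
proof -
  assume "in_ideal p N f" "in_ideal p N g"
  then obtain u v u' v' where "f = of_nat p * u + (X ^ N - 1) * v" "g = of_nat p * u' + (X ^ N - 1) * v'"
    unfolding in_ideal_def by blast
  hence "f + g = of_nat p * (u + u') + (X ^ N - 1) * (v + v')" by (simp only: distrib_left add.assoc add.left_commute)
  thus ?thesis unfolding in_ideal_def by blast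
qed

lemma in_ideal_mult: "in_ideal p N f \<Longrightarrow> in_ideal p N (f * g)"
proof -
  assume "in_ideal p N f"
  then obtain u v where "f = of_nat p * u + (X ^ N - 1) * v"
    unfolding in_ideal_def by blast
  hence "f * g = of_nat p * (u * g) + (X ^ N - 1) * (v * g)" by (simp only: distrib_right mult.assoc)
  thus ?thesis unfolding in_ideal_def by blast
qed

lemma in_ideal_mult_left: "in_ideal p N f \<Longrightarrow> in_ideal p N (g * f)"
  using in_ideal_mult[of p N f g] by (simp add: mult.commute)

lemma in_ideal_minus: "in_ideal p N f \<Longrightarrow> in_ideal p N (- f)"
  using in_ideal_mult_left[of p N f "- 1"] by simp

lemma in_ideal_diff: "in_ideal p N f \<Longrightarrow> in_ideal p N g \<Longrightarrow> in_ideal p N (f - g)"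
  unfolding diff_conv_add_uminus by (intro in_ideal_add in_ideal_minus)

lemma in_ideal_prime: "of_nat p dvd f \<Longrightarrow> in_ideal p N f"
proof -
  assume "of_nat p dvd f"
  then obtain u where "f = of_nat p * u + (X ^ N - 1) * 0" by auto
  thus ?thesis unfolding in_ideal_def by blast
qed

lemma in_ideal_X: "X ^ N - 1 dvd f \<Longrightarrow> in_ideal p N f"
proof -
  assume "X ^ N - 1 dvd f"
  then obtain v where "f = of_nat p * 0 + (X ^ N - 1) * v" by auto
  thus ?thesis unfolding in_ideal_def by blast
qed

text \<open>Modulo the ideal the \<open>N\<close>-th power map is additive, sends \<open>X\<close>
  to 1 and fixes constants, so only the augmentation \<open>poly f 1\<close> survives. Elements of
  augmentation prime to \<open>p\<close> are therefore invertible.\<close>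

lemma poly_power_in_ideal:
  assumes "prime p" and N: "N = p ^ k"
  shows "in_ideal p N (f ^ N - [:poly f 1:])"
proof (induction f)
  case 0
  thus ?case using assms by (simp add: in_ideal_prime prime_gt_0_nat power_0_left)
next
  case (pCons a f)
  have split: "pCons a f = [:a:] + X * f" by simp
  have 1: "in_ideal p N ((pCons a f) ^ N - ([:a:] ^ N + (X * f) ^ N))"
    unfolding split N by (intro in_ideal_prime prime_dvd_binomial_remainder_power assms)
  have "int p dvd a ^ N - a" unfolding N by (rule prime_dvd_power_prime_power_diff) fact
  then obtain b where "a ^ N - a = int p * b" by blast
  hence "[:a:] ^ N - [:a:] = of_nat p * [:b:]"
    by (simp add: poly_const_pow of_nat_poly)
  hence 2: "in_ideal p N ([:a:] ^ N - [:a:])" by (intro in_ideal_prime) (metis dvd_triv_left)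
  have 3: "in_ideal p N ((X ^ N - 1) * f ^ N)" by (intro in_ideal_X) simp
  have alg: "A - (B' + F') = (A - (B + C * F)) + ((B - B') + ((C - 1) * F + (F - F')))"
    for A B B' C F F' :: "int poly"
    by (simp add: algebra_simps)
  have "[:poly (pCons a f) 1:] = [:a:] + [:poly f 1:]" by simp
  hence eq: "(pCons a f) ^ N - [:poly (pCons a f) 1:] =
      ((pCons a f) ^ N - ([:a:] ^ N + X ^ N * f ^ N)) + (([:a:] ^ N - [:a:]) +
      ((X ^ N - 1) * f ^ N + (f ^ N - [:poly f 1:])))"
    by (simp only: alg)
  show ?case
    unfolding eq by (intro in_ideal_add 1[unfolded power_mult_distrib] 2 3 pCons.IH)
qed

lemma X_power_minus_1_dvd: "X ^ N - 1 dvd X ^ (N * c) - 1"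
proof -
  have "X ^ N - 1 dvd (X ^ N) ^ c - 1 ^ c"
    by (rule dvd_diff_imp_dvd_power_diff) simp
  thus ?thesis by (simp add: power_mult)
qed

lemma X_minus_1_mult_geometric: "(X - 1) * (\<Sum>i<N. X ^ i) = X ^ N - 1"
  by (simp add: power_diff_1_eq)

text \<open>Two factorizations with the same factor \<open>s\<close>: modulo \<open>X ^ Q - 1\<close> it has the cofactor \<open>a'\<close>, modulo
  \<open>X ^ (p * Q) - 1\<close> the cofactor \<open>a\<close>. Eliminating \<open>s\<close> leaves a multiplier of \<open>a\<close> which is invertible modulo
  \<open>p\<close>, since its augmentation is \<open>p - 1\<close>.\<close>

lemma mult_X_power_minus_1_in_ideal:
  fixes a a' s :: "int poly"
  assumes p: "prime p" and Q: "Q = p ^ k" and N: "N = p * Q"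
    and a': "X ^ (Q * (p - 1)) - 1 dvd a' * s - (\<Sum>i<Q * (p - 1). X ^ i)"
    and a: "X ^ (N * (p - 1)) - 1 dvd a * s - (\<Sum>i<N * (p - 1). X ^ i)"
  shows "in_ideal p N (a * (X ^ Q - 1))"
proof -
  obtain b' where b': "a' * s = (\<Sum>i<Q * (p - 1). X ^ i) + (X ^ (Q * (p - 1)) - 1) * b'"
    using a' by (metis dvd_def diff_eq_eq add.commute)
  obtain b where b: "a * s = (\<Sum>i<N * (p - 1). X ^ i) + (X ^ (N * (p - 1)) - 1) * b"
    using a by (metis dvd_def diff_eq_eq add.commute)
  \<comment> \<open>Chosen so that \<open>(X - 1) * (a' * s) = (X ^ Q - 1) * W\<close>; the
    geometric sum gives \<open>W\<close> the value \<open>p - 1\<close> at 1.\<close>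
  define W where "W = (\<Sum>i<p - 1. (X ^ Q) ^ i) * (1 + (X - 1) * b')"
  have geo: "(X ^ Q - 1) * (\<Sum>i<p - 1. (X ^ Q) ^ i) = X ^ (Q * (p - 1)) - 1"
    by (simp add: power_diff_1_eq power_mult)
  have "(X - 1) * (a' * s) = (X - 1) * (\<Sum>i<Q * (p - 1). X ^ i) + (X ^ (Q * (p - 1)) - 1) * ((X - 1) * b')"
    unfolding b' by (simp only: distrib_left mult.left_commute)
  also have "\<dots> = (X ^ (Q * (p - 1)) - 1) * (1 + (X - 1) * b')"
    unfolding X_minus_1_mult_geometric by (simp only: distrib_left mult_1_right)
  also have "\<dots> = (X ^ Q - 1) * W"
    unfolding W_def geo[symmetric] by (simp only: mult.assoc)
  finally have eq': "(X - 1) * (a' * s) = (X ^ Q - 1) * W" .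
  have "(X - 1) * (a * s) = (X - 1) * (\<Sum>i<N * (p - 1). X ^ i) + (X ^ (N * (p - 1)) - 1) * ((X - 1) * b)"
    unfolding b by (simp only: distrib_left mult.left_commute)
  also have "\<dots> = (X ^ (N * (p - 1)) - 1) * (1 + (X - 1) * b)"
    unfolding X_minus_1_mult_geometric by (simp only: distrib_left mult_1_right)
  finally have "X ^ (N * (p - 1)) - 1 dvd (X - 1) * (a * s)" by simp
  hence "X ^ N - 1 dvd (X - 1) * (a * s)"
    using X_power_minus_1_dvd dvd_trans by blast
  hence "X ^ N - 1 dvd a' * ((X - 1) * (a * s))" by (rule dvd_mult)
  also have "a' * ((X - 1) * (a * s)) = a * ((X - 1) * (a' * s))"
    by (simp only: mult.assoc mult.left_commute)
  also have "\<dots> = a * (X ^ Q - 1) * W"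
    unfolding eq' by (simp only: mult.assoc)
  finally have aW: "in_ideal p N (a * (X ^ Q - 1) * W)" by (rule in_ideal_X)
  have alg: "c * (V - (P - 1)) - c * V + P * c = c" for c V P :: "int poly"
    by (simp add: algebra_simps)
  have p1: "1 < p" using p prime_gt_1_nat by blast
  have N0: "0 < N" using p1 by (simp add: N Q)
  have "poly W 1 = int (p - 1)"
    by (simp add: W_def poly_sum poly_power)
  hence W1: "[:poly W 1:] = of_nat p - 1"
    using p1 by (simp add: of_nat_poly one_pCons)
  \<comment> \<open>\<open>W ^ N\<close> acts as \<open>p - 1\<close>, so
    \<open>a * (X ^ Q - 1)\<close>, which is annihilated by \<open>W\<close>, is annihilated by
    \<open>p - 1\<close>. It is also annihilated by \<open>p\<close>, hence it is zero in the
    quotient.\<close>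
  have "in_ideal p N (W ^ N - [:poly W 1:])"
    using p by (rule poly_power_in_ideal[where k = "Suc k"]) (simp add: N Q)
  hence "in_ideal p N (a * (X ^ Q - 1) * (W ^ N - (of_nat p - 1)))"
    unfolding W1 by (rule in_ideal_mult_left)
  moreover have "in_ideal p N (a * (X ^ Q - 1) * W * W ^ (N - 1))"
    using aW by (rule in_ideal_mult)
  moreover have "W * W ^ (N - 1) = W ^ N" using N0 by (metis power_eq_if neq0_conv)
  ultimately have "in_ideal p N (a * (X ^ Q - 1) * (W ^ N - (of_nat p - 1)) - a * (X ^ Q - 1) * W ^ N)"
    by (metis in_ideal_diff mult.assoc)
  moreover have "in_ideal p N (of_nat p * (a * (X ^ Q - 1)))"
    by (rule in_ideal_prime) simp
  ultimately have "in_ideal p N ((a * (X ^ Q - 1) * (W ^ N - (of_nat p - 1)) - a * (X ^ Q - 1) * W ^ N) +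
      of_nat p * (a * (X ^ Q - 1)))"
    by (rule in_ideal_add)
  also have "(a * (X ^ Q - 1) * (W ^ N - (of_nat p - 1)) - a * (X ^ Q - 1) * W ^ N) +
      of_nat p * (a * (X ^ Q - 1)) = a * (X ^ Q - 1)"
    by (rule alg)
  finally show ?thesis .
qed

section \<open>Linear functionals on polynomials, given by their values on powers of
  \<open>X\<close>\<close>

definition coeff_pairing :: "(nat \<Rightarrow> int) \<Rightarrow> int poly \<Rightarrow> int" where
  "coeff_pairing w f = (\<Sum>i\<le>degree f. coeff f i * w i)"

lemma coeff_pairing_eq: "degree f \<le> n \<Longrightarrow> coeff_pairing w f = (\<Sum>i\<le>n. coeff f i * w i)"
  unfolding coeff_pairing_def by (rule sum.mono_neutral_left) (auto simp: coeff_eq_0)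

lemma coeff_pairing_add: "coeff_pairing w (f + g) = coeff_pairing w f + coeff_pairing w g"
proof -
  let ?n = "max (degree f) (degree g)"
  have "degree (f + g) \<le> ?n" by (rule degree_add_le_max)
  thus ?thesis
    by (simp add: coeff_pairing_eq[of _ ?n] distrib_right sum.distrib)
qed

lemma coeff_pairing_0 [simp]: "coeff_pairing w 0 = 0"
  by (simp add: coeff_pairing_def)

lemma coeff_pairing_sum: "coeff_pairing w (\<Sum>y\<in>A. f y) = (\<Sum>y\<in>A. coeff_pairing w (f y))"
  by (induction A rule: infinite_finite_induct) (simp_all add: coeff_pairing_add)

lemma coeff_pairing_of_nat_mult: "coeff_pairing w (of_nat c * f) = int c * coeff_pairing w f"
proof -
  have "degree (of_nat c * f) \<le> degree f"
    by (simp add: of_nat_poly degree_smult_le)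
  thus ?thesis
    by (simp add: coeff_pairing_eq[of _ "degree f"] of_nat_poly sum_distrib_left mult.assoc)
qed

lemma coeff_pairing_diff: "coeff_pairing w (f - g) = coeff_pairing w f - coeff_pairing w g"
  using coeff_pairing_add[of w "f - g" g] by simp

lemma coeff_pairing_monom: "coeff_pairing w (monom c i) = c * w i"
  by (subst coeff_pairing_eq[of _ i]) (simp_all add: degree_monom_le if_distrib if_distribR cong: if_cong)

lemma coeff_pairing_X_power: "coeff_pairing w (X ^ i) = w i"
  using coeff_pairing_monom[of w 1 i] by (simp add: monom_altdef)

lemma dvd_coeff_pairing_X_power_minus_1:
  assumes "\<And>i. d dvd w (i + N) - w i"
  shows "d dvd coeff_pairing w ((X ^ N - 1) * f)"
proof -
  have "(X ^ N - 1) * monom c i = monom c (i + N) - monom c i" for c i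
  proof -
    have "X ^ N = monom 1 N" by (simp add: monom_altdef)
    thus ?thesis by (simp only: left_diff_distrib mult_monom mult_1 add.commute)
  qed
  hence "(X ^ N - 1) * f = (\<Sum>i\<le>degree f. monom (coeff f i) (i + N) - monom (coeff f i) i)"
    by (subst poly_as_sum_of_monoms[of f, symmetric]) (simp add: sum_distrib_left)
  hence "coeff_pairing w ((X ^ N - 1) * f) = (\<Sum>i\<le>degree f. coeff f i * (w (i + N) - w i))"
    by (simp add: coeff_pairing_sum coeff_pairing_diff coeff_pairing_monom right_diff_distrib)
  thus ?thesis using assms by (auto intro!: dvd_sum)
qed

text \<open>The functional with weights \<open>w\<close> is 1 on \<open>X ^ (i + Q) - X ^ i\<close>
  if \<open>Q dvd i\<close> and 0 otherwise. It vanishes modulo \<open>p\<close> on the ideal, since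
  a shift by \<open>p * Q\<close> changes \<open>w\<close> by 0 or \<open>p\<close>.\<close>

lemma prime_dvd_card_multiples:
  assumes "in_ideal p (p * Q) ((\<Sum>y\<in>A. X ^ l y) * (X ^ Q - 1))" and "0 < Q" "finite A"
  shows "p dvd card {y \<in> A. Q dvd l y}"
proof -
  define w where "w = (\<lambda>i. if Q dvd i then int (i div Q) else 0)"
  have w_Q: "w (i + Q) - w i = (if Q dvd i then 1 else 0)" for i
    using assms(2) by (auto simp: w_def)
  have w_N: "int p dvd w (i + p * Q) - w i" for i
    using assms(2) by (auto simp: w_def)
  obtain u v where uv: "(\<Sum>y\<in>A. X ^ l y) * (X ^ Q - 1) = of_nat p * u + (X ^ (p * Q) - 1) * v"
    using assms(1) unfolding in_ideal_def by blast
  have "int p dvd coeff_pairing w ((\<Sum>y\<in>A. X ^ l y) * (X ^ Q - 1))"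
    unfolding uv coeff_pairing_add coeff_pairing_of_nat_mult
    by (intro dvd_add dvd_coeff_pairing_X_power_minus_1 w_N) simp
  also have "(\<Sum>y\<in>A. X ^ l y) * (X ^ Q - 1) = (\<Sum>y\<in>A. X ^ (l y + Q) - X ^ l y)"
    unfolding sum_distrib_right by (rule sum.cong) (simp_all only: right_diff_distrib power_add mult_1_right)
  also have "coeff_pairing w \<dots> = (\<Sum>y\<in>A. if Q dvd l y then 1 else 0)"
    by (simp add: coeff_pairing_sum coeff_pairing_diff coeff_pairing_X_power w_Q)
  also have "\<dots> = int (card {y \<in> A. Q dvd l y})"
    using assms(3) by (simp add: sum.If_cases Int_def)
  finally show ?thesis by simp
qed

section \<open>Factorizations of unit groups\<close>

lemma primroot_power_cong_iff:
  fixes g n :: nat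
  assumes "residue_primroot n g"
  shows "[int g ^ i = int g ^ j] (mod int n) \<longleftrightarrow> [i = j] (mod totient n)"
proof -
  have "[int g ^ i = int g ^ j] (mod int n) \<longleftrightarrow> [g ^ i = g ^ j] (mod n)"
    by (simp flip: cong_int_iff)
  thus ?thesis
    using assms order_divides_expdiff[of n g i j] by (simp add: residue_primroot_def)
qed

lemma primroot_log_exists:
  fixes g n :: nat and u :: int
  assumes "residue_primroot n g" "1 < n" "coprime u (int n)"
  shows "\<exists>i. [int g ^ i = u] (mod int n)"
proof -
  define c where "c = nat (u mod int n)"
  have c: "int c = u mod int n" using assms(2) by (simp add: c_def)
  have cong: "[int c = u] (mod int n)" by (simp add: c cong_def)
  have "coprime (int c) (int n)" using assms(3) cong_imp_coprime[OF cong_sym[OF cong]] by blast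
  hence "coprime c n" by simp
  moreover from this have "c \<noteq> 0" using assms(2) by (intro notI) simp
  moreover have "c \<le> n"
    using c pos_mod_bound[of "int n" u] assms(2) by linarith
  ultimately have "c \<in> totatives n" by (simp add: totatives_def)
  hence "c \<in> (\<lambda>i. g ^ i mod n) ` {..<totient n}"
    using residue_primroot_is_generator[OF assms(2,1)] unfolding bij_betw_def by simp
  then obtain i where "g ^ i mod n = c" by auto
  hence "int g ^ i mod int n = int c" by (metis of_nat_mod of_nat_power)
  hence "[int g ^ i = u] (mod int n)" using c by (simp add: cong_def)
  thus ?thesis by blast
qed

lemma X_power_mod_dvd: "X ^ N - 1 dvd X ^ n - X ^ (n mod N)"
proof -
  have "X ^ n = X ^ (N * (n div N)) * X ^ (n mod N)"
    by (simp flip: power_add)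
  hence "X ^ n - X ^ (n mod N) = (X ^ (N * (n div N)) - 1) * X ^ (n mod N)"
    by (simp only: left_diff_distrib mult_1)
  thus ?thesis using X_power_minus_1_dvd dvd_mult2 by metis
qed

text \<open>Discrete logarithms turn the factorization of the unit group into a tiling of the
  exponents modulo \<open>totient n\<close>, which is a polynomial identity modulo
  \<open>X ^ totient n - 1\<close>.\<close>

lemma factorization_imp_dvd:
  fixes g n :: nat and B S :: "int set" and l :: "int \<Rightarrow> nat"
  assumes g: "residue_primroot n g" and n: "1 < n"
    and fin: "finite B" "finite S"
    and l: "\<And>u. u \<in> B \<union> S \<Longrightarrow> [int g ^ l u = u] (mod int n)"
    and cover: "\<And>u. coprime u (int n) \<Longrightarrow> \<exists>y\<in>B. \<exists>s\<in>S. [y * s = u] (mod int n)"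
    and unique: "\<And>y s y' s'. y \<in> B \<Longrightarrow> s \<in> S \<Longrightarrow> y' \<in> B \<Longrightarrow> s' \<in> S \<Longrightarrow>
      [y * s = y' * s'] (mod int n) \<Longrightarrow> y = y' \<and> s = s'"
  shows "X ^ totient n - 1 dvd
    (\<Sum>y\<in>B. X ^ l y) * (\<Sum>s\<in>S. X ^ l s) - (\<Sum>i<totient n. X ^ i)"
proof -
  define f where "f = (\<lambda>r :: int \<times> int. l (fst r) + l (snd r))"
  have f: "[int g ^ f r = fst r * snd r] (mod int n)" if "r \<in> B \<times> S" for r
    using that l cong_mult[of "int g ^ l (fst r)" "fst r" "int n" "int g ^ l (snd r)" "snd r"]
    by (auto simp: f_def power_add)
  have cop_g: "coprime (int g) (int n)"
    using g by (simp add: residue_primroot_def coprime_commute)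
  have tot: "0 < totient n" using n by simp
  have bij: "bij_betw (\<lambda>r. f r mod totient n) (B \<times> S) {..<totient n}"
    unfolding bij_betw_def
  proof
    show "inj_on (\<lambda>r. f r mod totient n) (B \<times> S)"
    proof (rule inj_onI)
      fix r r' assume r: "r \<in> B \<times> S" "r' \<in> B \<times> S" "f r mod totient n = f r' mod totient n"
      hence "[int g ^ f r = int g ^ f r'] (mod int n)"
        using primroot_power_cong_iff[OF g] by (simp add: cong_def)
      hence "[fst r * snd r = fst r' * snd r'] (mod int n)"
        using f[OF r(1)] f[OF r(2)] cong_sym cong_trans by blast
      thus "r = r'" using unique[of "fst r" "snd r" "fst r'" "snd r'"] r by (auto simp: prod_eq_iff)
    qed
    show "(\<lambda>r. f r mod totient n) ` (B \<times> S) = {..<totient n}"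
    proof (intro equalityI subsetI)
      fix i assume "i \<in> {..<totient n}"
      have "coprime (int g ^ i) (int n)" using cop_g by simp
      then obtain y s where ys: "y \<in> B" "s \<in> S" "[y * s = int g ^ i] (mod int n)"
        using cover by blast
      have "[int g ^ f (y, s) = int g ^ i] (mod int n)"
        using f[of "(y, s)"] ys cong_trans by auto
      hence "f (y, s) mod totient n = i"
        using primroot_power_cong_iff[OF g] \<open>i \<in> _\<close> by (simp add: cong_def)
      thus "i \<in> (\<lambda>r. f r mod totient n) ` (B \<times> S)" using ys by blast
    qed (use tot in auto)
  qed
  have "(\<Sum>y\<in>B. X ^ l y) * (\<Sum>s\<in>S. X ^ l s) = (\<Sum>r\<in>B \<times> S. X ^ f r)"
    by (simp add: sum_product sum.cartesian_product f_def power_add case_prod_unfold)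
  moreover have "(\<Sum>i<totient n. X ^ i) = (\<Sum>r\<in>B \<times> S. X ^ (f r mod totient n))"
    by (rule sum.reindex_bij_betw[OF bij, symmetric])
  ultimately have "(\<Sum>y\<in>B. X ^ l y) * (\<Sum>s\<in>S. X ^ l s) - (\<Sum>i<totient n. X ^ i) =
      (\<Sum>r\<in>B \<times> S. X ^ f r - X ^ (f r mod totient n))"
    by (simp only: sum_subtractf)
  moreover have "X ^ totient n - 1 dvd (\<Sum>r\<in>B \<times> S. X ^ f r - X ^ (f r mod totient n))"
    by (intro dvd_sum X_power_mod_dvd)
  ultimately show ?thesis by simp
qed

lemma prime_dvd_card_power_cong_1:
  fixes p e :: nat and A A' S :: "int set"
  assumes p: "prime p" "odd p" and fin: "finite A" "finite A'" "finite S"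
    and unit: "\<And>u. u \<in> A \<union> A' \<union> S \<Longrightarrow> \<not> int p dvd u"
    and cover': "\<And>u. \<not> int p dvd u \<Longrightarrow> \<exists>y\<in>A'. \<exists>s\<in>S. [y * s = u] (mod int p ^ Suc e)"
    and unique': "\<And>y s y' s'. y \<in> A' \<Longrightarrow> s \<in> S \<Longrightarrow> y' \<in> A' \<Longrightarrow> s' \<in> S \<Longrightarrow>
      [y * s = y' * s'] (mod int p ^ Suc e) \<Longrightarrow> y = y' \<and> s = s'"
    and cover: "\<And>u. \<not> int p dvd u \<Longrightarrow> \<exists>y\<in>A. \<exists>s\<in>S. [y * s = u] (mod int p ^ Suc (Suc e))"
    and unique: "\<And>y s y' s'. y \<in> A \<Longrightarrow> s \<in> S \<Longrightarrow> y' \<in> A \<Longrightarrow> s' \<in> S \<Longrightarrow>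
      [y * s = y' * s'] (mod int p ^ Suc (Suc e)) \<Longrightarrow> y = y' \<and> s = s'"
  shows "p dvd card {y \<in> A. [y ^ (p - 1) = 1] (mod int p ^ Suc e)}"
proof -
  \<comment> \<open>One generator for all powers of \<open>p\<close> lets the same logarithms serve
    both moduli.\<close>
  obtain g where g: "\<forall>k>0. residue_primroot (p ^ k) g"
    using residue_primroot_odd_prime_power_exists[OF p] by blast
  have p1: "1 < p" using p(1) prime_gt_1_nat by blast
  have cop_iff: "coprime u (int (p ^ Suc k)) \<longleftrightarrow> \<not> int p dvd u" for u k
  proof -
    have "coprime (int p) u \<longleftrightarrow> \<not> int p dvd u"
      using p(1) by (metis coprime_absorb_left not_prime_unit prime_imp_coprime prime_nat_int_transfer)
    thus ?thesis by (auto simp: coprime_commute)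
  qed
  have one_less: "1 < p ^ Suc k" for k using one_less_power[OF p1, of "Suc k"] by blast
  have gS: "residue_primroot (p ^ Suc k) g" for k using g by blast
  define l where "l = (\<lambda>u. SOME i. [int g ^ i = u] (mod int (p ^ Suc (Suc e))))"
  have l2: "[int g ^ l u = u] (mod int (p ^ Suc (Suc e)))" if "\<not> int p dvd u" for u
    unfolding l_def
    by (rule someI_ex, rule primroot_log_exists[OF gS one_less cop_iff[THEN iffD2, OF that]])
  have l1: "[int g ^ l u = u] (mod int (p ^ Suc e))" if "\<not> int p dvd u" for u
    using l2[OF that] by (rule cong_dvd_modulus) (simp add: le_imp_power_dvd)
  have tot: "totient (p ^ Suc k) = p ^ k * (p - 1)" for k
    using p(1) by (simp add: totient_prime_power del: power_Suc)
  define Q where "Q = p ^ e"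
  have "in_ideal p (p * Q) ((\<Sum>y\<in>A. X ^ l y) * (X ^ Q - 1))"
  proof (rule mult_X_power_minus_1_in_ideal[OF p(1) Q_def refl])
    show "X ^ (Q * (p - 1)) - 1 dvd
        (\<Sum>y\<in>A'. X ^ l y) * (\<Sum>s\<in>S. X ^ l s) - (\<Sum>i<Q * (p - 1). X ^ i)"
      unfolding Q_def tot[symmetric]
    proof (rule factorization_imp_dvd[OF gS one_less fin(2,3)])
      show "[int g ^ l u = u] (mod int (p ^ Suc e))" if "u \<in> A' \<union> S" for u
        using l1 unit that by blast
    qed (use cover' unique' in \<open>simp_all only: of_nat_power cop_iff[unfolded of_nat_power]\<close>)
    show "X ^ (p * Q * (p - 1)) - 1 dvd
        (\<Sum>y\<in>A. X ^ l y) * (\<Sum>s\<in>S. X ^ l s) - (\<Sum>i<p * Q * (p - 1). X ^ i)"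
      unfolding Q_def power_Suc[symmetric] tot[symmetric]
    proof (rule factorization_imp_dvd[OF gS one_less fin(1,3)])
      show "[int g ^ l u = u] (mod int (p ^ Suc (Suc e)))" if "u \<in> A \<union> S" for u
        using l2 unit that by blast
    qed (use cover unique in \<open>simp_all only: of_nat_power cop_iff[unfolded of_nat_power]\<close>)
  qed
  hence "p dvd card {y \<in> A. Q dvd l y}"
    by (rule prime_dvd_card_multiples) (use fin p1 in \<open>auto simp: Q_def\<close>)
  \<comment> \<open>As \<open>totient (p ^ Suc e) = Q * (p - 1)\<close>, the logarithm is a multiple
    of \<open>Q\<close> exactly when the power with exponent \<open>p - 1\<close> is
    trivial.\<close>
  also have "{y \<in> A. Q dvd l y} = {y \<in> A. [y ^ (p - 1) = 1] (mod int p ^ Suc e)}"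
  proof (intro Collect_cong conj_cong refl)
    fix y assume "y \<in> A"
    hence "[(int g ^ l y) ^ (p - 1) = y ^ (p - 1)] (mod int (p ^ Suc e))"
      using l1 unit by (intro cong_pow) auto
    hence "[y ^ (p - 1) = 1] (mod int (p ^ Suc e)) \<longleftrightarrow>
        [(int g ^ l y) ^ (p - 1) = 1] (mod int (p ^ Suc e))"
      using cong_trans cong_sym by blast
    also have "\<dots> \<longleftrightarrow> [int g ^ (l y * (p - 1)) = int g ^ 0] (mod int (p ^ Suc e))"
      by (simp add: power_mult)
    also have "\<dots> \<longleftrightarrow> [l y * (p - 1) = 0] (mod totient (p ^ Suc e))"
      by (rule primroot_power_cong_iff[OF gS])
    also have "\<dots> \<longleftrightarrow> Q * (p - 1) dvd l y * (p - 1)"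
      unfolding tot Q_def by (simp add: cong_0_iff)
    also have "\<dots> \<longleftrightarrow> Q dvd l y" using p1 by simp
    finally show "Q dvd l y \<longleftrightarrow> [y ^ (p - 1) = 1] (mod int p ^ Suc e)" by simp
  qed
  finally show ?thesis .
qed

section \<open>Odd modulus\<close>

context interval_splitting
begin

text \<open>Since \<open>p - 1\<close> is even, an odd \<open>card S\<close> is at most
  \<open>p - 2\<close>; this is the extra room required by
  \<open>card_splitter_le_if_coprime\<close>.\<close>

lemma coprime_splitter_card:
  assumes p: "prime p" "odd p" "p \<le> k2" and cop: "\<And>s. s \<in> S \<Longrightarrow> coprime s m"
    and "int (card S) \<le> p - 1" "m < (k2 + 1)\<^sup>2"
  shows "card S = 1 \<or> card S = 2 \<and> k1 = 0"
proof -
  have "int (card S) \<le> 1 \<or> int (card S) = 2 \<and> k1 = 0"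
  proof (rule card_splitter_le_if_coprime)
    assume "odd (int (card S))"
    moreover have "even (p - 1)" using p(2) by simp
    ultimately have "int (card S) \<noteq> p - 1" by metis
    thus "int (card S) + 2 \<le> k2" using assms by linarith
  qed (use assms in auto)
  moreover have "card S \<noteq> 0" using m_eq m_gt_1 by (intro notI) simp
  ultimately show ?thesis by linarith
qed

text \<open>A splitter divisible by one prime would be annihilated by the other, against
  \<open>order_gt\<close>, so all splitters are units.\<close>

lemma card_splitter_prime_product:
  assumes p: "prime p" "odd p" "prime q" "p < q" "q \<le> k2" and m: "m = p * q"
  shows "card S = 1 \<or> card S = 2 \<and> k1 = 0"
proof (rule coprime_splitter_card)
  have pos: "0 < p" "0 < q" using p by (auto simp: prime_gt_0_int)
  have q2: "2 \<le> q" using p(3) by (rule prime_ge_2_int)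
  show "coprime s m" if "s \<in> S" for s
  proof -
    have "\<not> p dvd s"
    proof
      assume "p dvd s"
      hence "m dvd q * s" by (auto simp: m)
      thus False using order_gt[OF that pos(2)] p k1_nonneg by simp
    qed
    moreover have "\<not> q dvd s"
    proof
      assume "q dvd s"
      hence "m dvd p * s" by (auto simp: m)
      thus False using order_gt[OF that pos(1)] p k1_nonneg by simp
    qed
    ultimately show ?thesis
      using p prime_imp_coprime[of p s] prime_imp_coprime[of q s] by (simp add: m coprime_commute)
  qed
  show "int (card S) \<le> p - 1"
  proof -
    \<comment> \<open>The \<open>p - 1\<close> nonzero multiples of \<open>q\<close> are the
      products of multipliers divisible by \<open>q\<close> with arbitrary splitters, so
      \<open>card S\<close> divides \<open>p - 1\<close>.\<close>
    have "card {g \<in> {0..<m}. q dvd g \<and> \<not> m dvd g} = card {x \<in> M. q dvd x} * card {s \<in> S. True}"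
    proof (rule card_residues_mult)
      fix g h assume "[g = h] (mod m)"
      thus "(q dvd g \<and> \<not> m dvd g) = (q dvd h \<and> \<not> m dvd h)"
        using dvd_cong_int[of g h m q] dvd_cong_int[of g h m m] m by auto
    next
      fix x s assume xs: "x \<in> M" "s \<in> S"
      have "\<not> q dvd s"
      proof
        assume "q dvd s"
        hence "m dvd p * s" by (auto simp: m)
        thus False using order_gt[OF xs(2) pos(1)] p k1_nonneg by simp
      qed
      thus "(q dvd x * s \<and> \<not> m dvd x * s) = (q dvd x \<and> True)"
        using nonzero[OF xs] p(3) by (simp add: prime_dvd_mult_iff)
    qed simp
    moreover have "{g \<in> {0..<m}. q dvd g \<and> \<not> m dvd g} = (*) q ` {1..<p}"
    proof (intro equalityI subsetI)
      fix g assume g: "g \<in> {g \<in> {0..<m}. q dvd g \<and> \<not> m dvd g}"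
      then obtain h where h: "g = q * h" by blast
      hence "0 \<le> q * h" "q * h < q * p" "h \<noteq> 0" using g by (auto simp: m mult.commute)
      thus "g \<in> (*) q ` {1..<p}" using pos h by (auto simp: zero_le_mult_iff)
    next
      fix g assume "g \<in> (*) q ` {1..<p}"
      then obtain h where "g = q * h" "h \<in> {1..<p}" by blast
      hence h: "g = q * h" "1 \<le> h" "h < p" by auto
      have "\<not> p dvd h" using h dvd_less_imp_zero[of p h] by auto
      thus "g \<in> {g \<in> {0..<m}. q dvd g \<and> \<not> m dvd g}" using h pos by (auto simp: m mult.commute)
    qed
    ultimately have "p - 1 = int (card {x \<in> M. q dvd x}) * int (card S)"
      using pos by (simp add: card_image inj_on_def flip: of_nat_mult)
    hence "int (card S) dvd p - 1" by simp
    thus ?thesis using p(1) prime_ge_2_int[of p] by (intro zdvd_imp_le) auto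
  qed
  have "p * q < q * q" using p pos by (intro mult_strict_right_mono) auto
  also have "\<dots> \<le> (k2 + 1) * (k2 + 1)" using p pos by (intro mult_mono) auto
  finally show "m < (k2 + 1)\<^sup>2" by (simp add: m power2_eq_square)
qed (use p in auto)

end

section \<open>Odd prime powers and \<open>p\<close>-adic valuations\<close>

lemma prime_power_level_iff:
  fixes p x :: int
  assumes "prime p" "x \<noteq> 0"
  shows "p ^ j dvd x \<and> \<not> p ^ Suc j dvd x \<longleftrightarrow> multiplicity p x = j"
proof -
  have "\<not> is_unit p" using assms(1) by auto
  hence "p ^ i dvd x \<longleftrightarrow> i \<le> multiplicity p x" for i
    using assms(2) by (intro power_dvd_iff_le_multiplicity) auto
  thus ?thesis by (auto simp del: power_Suc)
qed

lemma card_prime_power_level: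
  fixes p :: nat
  assumes "prime p" "j < b"
  shows "card {g \<in> {0..<int p ^ b}. int p ^ j dvd g \<and> \<not> int p ^ Suc j dvd g} = p ^ (b - 1 - j) * (p - 1)"
proof -
  have p: "1 < p" using assms(1) prime_gt_1_nat by blast
  have div: "int p ^ b div int p ^ i = int p ^ (b - i)" if "i \<le> b" for i
    using p that by (simp add: power_diff)
  have mult: "card {g \<in> {0..<int p ^ b}. int p ^ i dvd g} = p ^ (b - i)" if "i \<le> b" for i
  proof -
    have "int (card {g \<in> {0..<int p ^ b}. int p ^ i dvd g}) = int p ^ b div int p ^ i"
      by (rule card_multiples) (use p that in \<open>auto simp: le_imp_power_dvd\<close>)
    thus ?thesis using div[OF that] by (metis of_nat_eq_iff of_nat_power)
  qed
  have "{g \<in> {0..<int p ^ b}. int p ^ Suc j dvd g \<and> int p ^ j dvd g} = {g \<in> {0..<int p ^ b}. int p ^ Suc j dvd g}"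
    by (auto intro: dvd_trans[rotated] simp: dvd_mult_right)
  hence "p ^ (b - j) = p ^ (b - Suc j) +
      card {g \<in> {0..<int p ^ b}. int p ^ j dvd g \<and> \<not> int p ^ Suc j dvd g}"
    using card_filter_split[of "{0..<int p ^ b}" "\<lambda>g. int p ^ j dvd g" "\<lambda>g. int p ^ Suc j dvd g"]
      mult[of j] mult[of "Suc j"] assms(2) by simp
  moreover have "b - j = Suc (b - 1 - j)" "b - Suc j = b - 1 - j" using assms(2) by simp_all
  ultimately have "p ^ (b - 1 - j) * p = p ^ (b - 1 - j) +
      card {g \<in> {0..<int p ^ b}. int p ^ j dvd g \<and> \<not> int p ^ Suc j dvd g}"
    by (simp only: power_Suc2)
  thus ?thesis by (simp only: diff_mult_distrib2)
qed

text \<open>The cofactor of \<open>y - z\<close> in \<open>y ^ n - z ^ n\<close> is a sum of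
  \<open>n\<close> terms, each congruent to \<open>z ^ (n - 1)\<close> modulo
  \<open>n\<close>.\<close>

lemma prime_square_dvd_power_diff:
  fixes y z :: int
  assumes "int n dvd y - z"
  shows "int n ^ 2 dvd y ^ n - z ^ n"
proof -
  have yz: "[y = z] (mod int n)" using assms by (simp add: cong_iff_dvd_diff)
  have "[(\<Sum>i<n. z ^ (n - Suc i) * y ^ i) = (\<Sum>i<n. z ^ (n - 1))] (mod int n)"
  proof (rule cong_sum)
    fix i assume "i \<in> {..<n}"
    hence "z ^ (n - 1) = z ^ (n - Suc i) * z ^ i" by (simp flip: power_add)
    thus "[z ^ (n - Suc i) * y ^ i = z ^ (n - 1)] (mod int n)"
      using cong_scalar_left[OF cong_pow[OF yz]] by simp
  qed
  moreover have "int n dvd (\<Sum>i<n. z ^ (n - 1))" by simp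
  ultimately have "int n dvd (\<Sum>i<n. z ^ (n - Suc i) * y ^ i)" by (simp add: cong_dvd_iff)
  thus ?thesis unfolding power_diff_sumr2 power2_eq_square using assms by (intro mult_dvd_mono)
qed

context interval_splitting
begin

lemma S_nonzero: "s \<in> S \<Longrightarrow> s \<noteq> 0"
  using nonzero[of 1 s] k1_nonneg k2_ge by (auto simp: M_iff)

context
  fixes p :: nat and b :: nat
  assumes p: "prime p" "odd p" "int p \<le> k2" and m_pp: "m = int p ^ b"
begin

abbreviation v :: "int \<Rightarrow> nat" where "v \<equiv> multiplicity (int p)"

text \<open>For \<open>j < b\<close> these pairs correspond to the residues modulo \<open>m\<close>
  of valuation exactly \<open>j\<close>.\<close>

definition level :: "nat \<Rightarrow> (int \<times> int) set" where
  "level j = {r \<in> M \<times> S. v (fst r) + v (snd r) = j}"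

definition MV :: "nat \<Rightarrow> int set" where "MV j = {x \<in> M. v x = j}"

definition SV :: "nat \<Rightarrow> int set" where "SV j = {s \<in> S. v s = j}"

lemma prime_int_p: "prime (int p)"
  using p(1) by simp

lemma p_gt_1: "1 < p"
  using p(1) prime_gt_1_nat by blast

lemma finite_level [simp]: "finite (level j)" "finite (MV j)" "finite (SV j)"
  by (simp_all add: level_def MV_def SV_def)

lemma product_level_iff:
  assumes "x \<in> M" "s \<in> S"
  shows "int p ^ j dvd x * s \<and> \<not> int p ^ Suc j dvd x * s \<longleftrightarrow> v x + v s = j"
proof -
  have nz: "x \<noteq> 0" "s \<noteq> 0" using assms S_nonzero by (auto simp: M_iff)
  thus ?thesis
    using prime_power_level_iff[OF prime_int_p, of "x * s" j] prime_int_p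
    by (simp add: prime_elem_multiplicity_mult_distrib)
qed

lemma card_level:
  assumes "j < b"
  shows "card (level j) = p ^ (b - 1 - j) * (p - 1)"
proof -
  have dvd_m: "int p ^ Suc j dvd m" "int p ^ j dvd m"
    using assms by (auto simp: m_pp intro!: le_imp_power_dvd simp del: power_Suc)
  have "card {g \<in> {0..<m}. int p ^ j dvd g \<and> \<not> int p ^ Suc j dvd g} =
      card {r \<in> M \<times> S. int p ^ j dvd fst r * snd r \<and> \<not> int p ^ Suc j dvd fst r * snd r}"
  proof (rule card_residues)
    fix g h assume "[g = h] (mod m)"
    thus "(int p ^ j dvd g \<and> \<not> int p ^ Suc j dvd g) = (int p ^ j dvd h \<and> \<not> int p ^ Suc j dvd h)"
      using dvd_cong_int dvd_m by blast
  qed simp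
  also have "{r \<in> M \<times> S. int p ^ j dvd fst r * snd r \<and> \<not> int p ^ Suc j dvd fst r * snd r} = level j"
    unfolding level_def by (intro Collect_cong conj_cong refl product_level_iff) auto
  finally show ?thesis
    using card_prime_power_level[OF p(1) assms] by (simp add: m_pp)
qed

lemma MV_SV_sub_level: "MV i \<times> SV j \<subseteq> level (i + j)"
  by (auto simp: level_def MV_def SV_def)

lemma card_MV_SV_le: "card (MV i) * card (SV j) \<le> card (level (i + j))"
  using card_mono[OF finite_level(1) MV_SV_sub_level] by (simp add: card_cartesian_product)

lemma power_mem_MV: "int p ^ j \<le> k2 \<Longrightarrow> int p ^ j \<in> MV j"
  using p_gt_1 k1_nonneg prime_int_p by (auto simp: MV_def M_iff multiplicity_same_power intro: order_trans[of _ 0])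

section \<open>The largest power \<open>p ^ t\<close> not exceeding \<open>k2\<close>\<close>

context
  fixes t :: nat
  assumes t: "int p ^ t \<le> k2" "k2 < int p ^ Suc t"
begin

lemma t_pos: "0 < t"
  using t p(3) by (cases t) auto

lemma t_less_b: "t < b"
proof (rule ccontr)
  assume "\<not> t < b"
  hence "m \<le> int p ^ t" using p_gt_1 by (simp add: m_pp power_increasing)
  moreover have "S \<noteq> {}" using m_eq m_gt_1 by auto
  then obtain s where "s \<in> S" by blast
  hence "k1 + k2 < m" using order_gt[of s m] m_gt_1 by simp
  ultimately show False using t k1_nonneg by simp
qed

lemma v_M_le: "x \<in> M \<Longrightarrow> v x \<le> t"
proof (rule ccontr)
  assume x: "x \<in> M" "\<not> v x \<le> t"
  hence "int p ^ Suc t dvd x" by (intro multiplicity_dvd') auto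
  hence "int p ^ Suc t \<le> \<bar>x\<bar>" using x(1) dvd_imp_le_int[of x "int p ^ Suc t"] by (auto simp: M_iff)
  thus False using x(1) t k1_le_k2 by (auto simp: M_iff)
qed

text \<open>\<open>p ^ (b - v s)\<close> annihilates \<open>s\<close>, so by \<open>order_gt\<close>
  it exceeds \<open>k1 + k2\<close> and hence \<open>p ^ t\<close>.\<close>

lemma v_S_bound:
  assumes "s \<in> S"
  shows "v s + t < b" "k1 + k2 < int p ^ (b - v s)"
proof -
  have "\<not> int p ^ b dvd s"
    using assms S_sub S_nonzero[OF assms] dvd_less_imp_zero[of m s] by (auto simp: m_pp)
  hence less: "v s < b" using multiplicity_dvd' by (metis not_less)
  have "int p ^ v s dvd s" by (rule multiplicity_dvd)
  hence "int p ^ (b - v s) * int p ^ v s dvd int p ^ (b - v s) * s" by (intro mult_dvd_mono) auto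
  hence "m dvd int p ^ (b - v s) * s" using less by (simp add: m_pp flip: power_add)
  thus K: "k1 + k2 < int p ^ (b - v s)"
    using order_gt[OF assms, of "int p ^ (b - v s)"] p_gt_1 by simp
  hence "int p ^ t < int p ^ (b - v s)" using t k1_nonneg by linarith
  hence "t < b - v s" using p_gt_1 by (simp add: power_strict_increasing_iff)
  thus "v s + t < b" by simp
qed

text \<open>Elements of order \<open>p ^ (i + 1)\<close> with \<open>i \<le> t\<close> arise from splitters of order \<open>p ^ (t + 1)\<close>, and
  elements of valuation \<open>t\<close> from unit splitters; counting at both ends of the chain gives opposite
  inequalities between \<open>card (MV 0)\<close> and \<open>p ^ t * card (MV t)\<close>.\<close>

lemma card_MV_0: "card (MV 0) = p ^ t * card (MV t)"
  and card_SV_pos: "0 < card (SV (b - 1 - t))"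
proof -
  \<comment> \<open>The bounds on the two valuations add up to \<open>b - 1\<close>, so on this
    level both must be attained.\<close>
  have "level (b - 1) = MV t \<times> SV (b - 1 - t)"
    using v_M_le v_S_bound(1) t_less_b by (fastforce simp: level_def MV_def SV_def)
  hence 1: "card (MV t) * card (SV (b - 1 - t)) = p - 1"
    using card_level[of "b - 1"] t_less_b by (simp add: card_cartesian_product)
  thus 2: "0 < card (SV (b - 1 - t))" using p_gt_1 by (intro gr0I) simp
  have "level 0 = MV 0 \<times> SV 0" by (auto simp: level_def MV_def SV_def)
  hence 3: "card (MV 0) * card (SV 0) = p ^ (b - 1) * (p - 1)"
    using card_level[of 0] t_less_b by (simp add: card_cartesian_product)
  hence 4: "0 < card (SV 0)" using p_gt_1 by (intro gr0I) simp
  have "card (MV 0) * card (SV (b - 1 - t)) \<le> p ^ t * (p - 1)"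
    using card_MV_SV_le[of 0 "b - 1 - t"] card_level[of "b - 1 - t"] t_less_b by simp
  also have "\<dots> = p ^ t * card (MV t) * card (SV (b - 1 - t))"
    using 1 by simp
  finally have 5: "card (MV 0) \<le> p ^ t * card (MV t)" using 2 by simp
  have "p ^ t * (card (MV t) * card (SV 0)) \<le> p ^ t * (p ^ (b - 1 - t) * (p - 1))"
    using card_MV_SV_le[of t 0] card_level[of t] t_less_b by (intro mult_left_mono) auto
  also have "p ^ t * (p ^ (b - 1 - t) * (p - 1)) = p ^ (b - 1) * (p - 1)"
    using t_less_b by (simp flip: power_add mult.assoc)
  also have "\<dots> = card (MV 0) * card (SV 0)" using 3 by simp
  finally have "p ^ t * card (MV t) * card (SV 0) \<le> card (MV 0) * card (SV 0)" by (simp add: mult.assoc)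
  hence "p ^ t * card (MV t) \<le> card (MV 0)" using 4 by simp
  thus "card (MV 0) = p ^ t * card (MV t)" using 5 by simp
qed

text \<open>With \<open>card_MV_0\<close>, the count of level 0 shows that the products of
  \<open>MV t\<close> with unit splitters already fill level \<open>t\<close>.\<close>

lemma level_t_eq: "level t = MV t \<times> SV 0" "card (MV t) * card (SV 0) = p ^ (b - 1 - t) * (p - 1)"
proof -
  have "level 0 = MV 0 \<times> SV 0" by (auto simp: level_def MV_def SV_def)
  hence "card (MV 0) * card (SV 0) = p ^ (b - 1) * (p - 1)"
    using card_level[of 0] t_less_b by (simp add: card_cartesian_product)
  also have "\<dots> = p ^ t * (p ^ (b - 1 - t) * (p - 1))"
    using t_less_b by (simp flip: power_add mult.assoc)
  finally have "p ^ t * (card (MV t) * card (SV 0)) = p ^ t * (p ^ (b - 1 - t) * (p - 1))"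
    by (simp add: card_MV_0 mult.assoc)
  thus eq: "card (MV t) * card (SV 0) = p ^ (b - 1 - t) * (p - 1)" using p_gt_1 by simp
  have "MV t \<times> SV 0 = level t"
    using MV_SV_sub_level[of t 0] eq card_level[OF t_less_b]
    by (intro card_subset_eq) (auto simp: card_cartesian_product)
  thus "level t = MV t \<times> SV 0" by simp
qed

text \<open>Otherwise \<open>p ^ (t - v s)\<close> and \<open>s\<close> would form a pair of level
  \<open>t\<close> whose splitter is not a unit.\<close>

lemma v_S_cases:
  assumes "s \<in> S"
  shows "v s = 0 \<or> t < v s"
proof (rule ccontr)
  assume *: "\<not> (v s = 0 \<or> t < v s)"
  have "int p ^ (t - v s) \<le> int p ^ t" using p_gt_1 by (intro power_increasing) auto
  hence "int p ^ (t - v s) \<in> MV (t - v s)" using t by (intro power_mem_MV) simp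
  hence "(int p ^ (t - v s), s) \<in> level t" using assms * by (auto simp: level_def MV_def)
  thus False using * unfolding level_t_eq(1) by (simp add: SV_def)
qed

lemma level_eq:
  assumes "j \<le> t" "r \<in> M \<times> S" "v (fst r) + v (snd r) = j"
  shows "snd r \<in> SV 0" "v (fst r) = j"
  using v_S_cases[of "snd r"] assms by (auto simp: SV_def)

text \<open>The elements of valuation exactly \<open>j \<le> t\<close>, divided by \<open>p ^ j\<close>, give a factorization of the
  units modulo \<open>p ^ (b - j)\<close> whose second factor does not depend on \<open>j\<close>.\<close>

definition cofactor :: "nat \<Rightarrow> int set" where
  "cofactor j = {y. \<not> int p dvd y \<and> int p ^ j * y \<in> M}"

lemma cofactor_cover:
  assumes "j \<le> t" "\<not> int p dvd u"
  shows "\<exists>y\<in>cofactor j. \<exists>s\<in>SV 0. [y * s = u] (mod int p ^ (b - j))"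
proof -
  have jb: "j < b" using assms t_less_b by simp
  have m_split: "m = int p ^ j * int p ^ (b - j)" using jb by (simp add: m_pp flip: power_add)
  have lev: "int p ^ j dvd int p ^ j * u" "\<not> int p ^ Suc j dvd int p ^ j * u"
    using assms(2) p_gt_1 by auto
  have dvd: "int p ^ Suc j dvd m" "int p ^ j dvd m"
    using jb by (auto simp: m_pp intro!: le_imp_power_dvd simp del: power_Suc)
  have "\<not> m dvd int p ^ j * u" using dvd(1) lev(2) dvd_trans by blast
  then obtain x s where xs: "x \<in> M" "s \<in> S" "[x * s = int p ^ j * u] (mod m)"
    using cover by blast
  have "int p ^ j dvd x * s \<and> \<not> int p ^ Suc j dvd x * s"
    using dvd_cong_int[OF xs(3) dvd(1)] dvd_cong_int[OF xs(3) dvd(2)] lev by blast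
  hence "v x + v s = j" using product_level_iff[OF xs(1,2)] by blast
  hence s: "s \<in> SV 0" and vx: "v x = j" using level_eq[of j "(x, s)"] assms(1) xs by auto
  have "int p ^ j dvd x \<and> \<not> int p ^ Suc j dvd x"
    using vx xs(1) prime_power_level_iff[OF prime_int_p, of x j] by (auto simp: M_iff)
  then obtain y where y: "x = int p ^ j * y" "\<not> int p dvd y" using p_gt_1 by auto
  hence "y \<in> cofactor j" using xs(1) by (simp add: cofactor_def)
  moreover have "[y * s = u] (mod int p ^ (b - j))"
  proof -
    have "int p ^ j * int p ^ (b - j) dvd int p ^ j * (y * s - u)"
      using xs(3) by (simp add: cong_iff_dvd_diff y m_split algebra_simps)
    thus ?thesis using p_gt_1 by (simp add: cong_iff_dvd_diff)
  qed
  ultimately show ?thesis using s by blast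
qed

lemma cofactor_unique:
  assumes "j \<le> t" "y \<in> cofactor j" "s \<in> SV 0" "y' \<in> cofactor j" "s' \<in> SV 0"
    "[y * s = y' * s'] (mod int p ^ (b - j))"
  shows "y = y' \<and> s = s'"
proof -
  have m_split: "m = int p ^ j * int p ^ (b - j)"
    using assms(1) t_less_b by (simp add: m_pp flip: power_add)
  have "int p ^ j * int p ^ (b - j) dvd int p ^ j * (y * s - y' * s')"
    using assms(6) by (simp add: cong_iff_dvd_diff)
  hence "[(int p ^ j * y) * s = (int p ^ j * y') * s'] (mod m)"
    by (simp add: cong_iff_dvd_diff m_split algebra_simps)
  thus ?thesis
    using unique[of "int p ^ j * y" s "int p ^ j * y'" s'] assms p_gt_1
    by (auto simp: cofactor_def SV_def)
qed

lemma finite_cofactor [simp]: "finite (cofactor j)"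
proof -
  have "(*) (int p ^ j) ` cofactor j \<subseteq> M" by (auto simp: cofactor_def)
  hence "finite ((*) (int p ^ j) ` cofactor j)" by (rule finite_subset) simp
  thus ?thesis by (rule finite_imageD) (use p_gt_1 in \<open>auto simp: inj_on_def\<close>)
qed

lemma not_dvd_SV_0: "s \<in> SV 0 \<Longrightarrow> \<not> int p dvd s"
  using prime_power_level_iff[OF prime_int_p, of s 0] S_nonzero by (auto simp: SV_def)

lemma exponent_eq_Suc: "b = Suc t"
proof (rule ccontr)
  assume "b \<noteq> Suc t"
  \<comment> \<open>Levels \<open>t\<close> and \<open>t - 1\<close> then give factorizations modulo
    \<open>p ^ (e + 2)\<close> and \<open>p ^ (e + 3)\<close>, with the common factor
    \<open>SV 0\<close>.\<close>
  then obtain e where e: "b - t = Suc (Suc e)" using t_less_b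
    by (metis Suc_diff_Suc Suc_lessI zero_less_diff gr0_implies_Suc)
  obtain t' where t': "t = Suc t'" using t_pos gr0_implies_Suc by blast
  have e': "b - t' = Suc (Suc (Suc e))" using e t' by simp
  define T where "T = {y \<in> cofactor t'. [y ^ (p - 1) = 1] (mod int p ^ Suc (Suc e))}"
  have "p dvd card T"
    unfolding T_def
  proof (rule prime_dvd_card_power_cong_1[OF p(1,2), of _ "cofactor t" "SV 0"])
    show "\<exists>y\<in>cofactor t. \<exists>s\<in>SV 0. [y * s = u] (mod int p ^ Suc (Suc e))" if "\<not> int p dvd u" for u
      using cofactor_cover[of t u] that e by simp
    show "\<exists>y\<in>cofactor t'. \<exists>s\<in>SV 0. [y * s = u] (mod int p ^ Suc (Suc (Suc e)))" if "\<not> int p dvd u" for u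
      using cofactor_cover[of t' u] that e' t' by simp
    show "y = y' \<and> s = s'" if "y \<in> cofactor t" "s \<in> SV 0" "y' \<in> cofactor t" "s' \<in> SV 0"
        "[y * s = y' * s'] (mod int p ^ Suc (Suc e))" for y s y' s'
      using cofactor_unique[of t y s y' s'] that e by simp
    show "y = y' \<and> s = s'" if "y \<in> cofactor t'" "s \<in> SV 0" "y' \<in> cofactor t'" "s' \<in> SV 0"
        "[y * s = y' * s'] (mod int p ^ Suc (Suc (Suc e)))" for y s y' s'
      using cofactor_unique[of t' y s y' s'] that e' t' by simp
    show "\<not> int p dvd u" if "u \<in> cofactor t' \<union> cofactor t \<union> SV 0" for u
      using that not_dvd_SV_0 by (auto simp: cofactor_def)
  qed simp_all
  moreover have "1 \<in> T"
  proof -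
    have "int p ^ t' \<le> int p ^ t" using p_gt_1 t' by (intro power_increasing) auto
    hence "int p ^ t' \<in> M" using t power_mem_MV[of t'] by (simp add: MV_def)
    thus ?thesis using p_gt_1 by (simp add: T_def cofactor_def)
  qed
  moreover have finT: "finite T" by (simp add: T_def)
  ultimately have "p \<le> card T" by (metis card_gt_0_iff dvd_imp_le empty_iff)
  \<comment> \<open>Members of \<open>T\<close> congruent modulo \<open>p\<close> agree modulo
    \<open>p ^ 2\<close>, because there \<open>w ^ p\<close> equals \<open>w\<close>. They are
    closer than \<open>p ^ 2\<close>, since a splitter of valuation \<open>b - 1 - t\<close> forces
    \<open>k1 + k2 < p ^ Suc t\<close>.\<close>
  moreover have "inj_on (\<lambda>y. y mod int p) T"
  proof (rule inj_onI)
    fix y z assume yz: "y \<in> T" "z \<in> T" "y mod int p = z mod int p"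
    have pow: "[w ^ p = w] (mod int p ^ 2)" if "w \<in> T" for w
    proof -
      have "[w ^ (p - 1) = 1] (mod int p ^ 2)"
        by (rule cong_dvd_modulus[of _ _ "int p ^ Suc (Suc e)"])
          (use that in \<open>auto simp: T_def intro!: le_imp_power_dvd simp del: power_Suc\<close>)
      hence "[w ^ (p - 1) * w = 1 * w] (mod int p ^ 2)" by (rule cong_scalar_right)
      thus ?thesis using p_gt_1 by (simp flip: power_Suc2)
    qed
    have "int p dvd y - z" using yz(3) by (simp add: mod_eq_dvd_iff)
    hence "int p ^ 2 dvd y ^ p - z ^ p" by (rule prime_square_dvd_power_diff)
    hence "[y ^ p = z ^ p] (mod int p ^ 2)" by (simp add: cong_iff_dvd_diff)
    hence "[y = z] (mod int p ^ 2)"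
      using pow[OF yz(1)] pow[OF yz(2)] cong_sym cong_trans by meson
    hence dvd: "int p ^ 2 dvd \<bar>y - z\<bar>" by (simp add: cong_iff_dvd_diff)
    have "int p ^ t' * \<bar>y - z\<bar> = \<bar>int p ^ t' * y - int p ^ t' * z\<bar>"
      by (simp add: abs_mult flip: right_diff_distrib)
    also have "\<dots> \<le> k1 + k2"
      using yz(1,2) by (auto simp: T_def cofactor_def M_iff)
    also have "k1 + k2 < int p ^ t' * int p ^ 2"
    proof -
      obtain s where "s \<in> SV (b - 1 - t)" using card_SV_pos by fastforce
      hence "k1 + k2 < int p ^ (b - (b - 1 - t))" using v_S_bound(2)[of s] by (auto simp: SV_def)
      thus ?thesis using t_less_b t' by (simp add: power2_eq_square mult_ac)
    qed
    finally have "\<bar>y - z\<bar> < int p ^ 2" using p_gt_1 by simp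
    thus "y = z" using dvd_less_imp_zero[OF dvd] by simp
  qed
  moreover have "(\<lambda>y. y mod int p) ` T \<subseteq> {1..<int p}"
  proof safe
    fix y assume "y \<in> T"
    hence "y mod int p \<noteq> 0" by (auto simp: T_def cofactor_def dvd_eq_mod_eq_0)
    moreover have "0 \<le> y mod int p" "y mod int p < int p" using p_gt_1 by simp_all
    ultimately show "y mod int p \<in> {1..<int p}" by simp
  qed
  ultimately have "card T \<le> card {1..<int p}" by (intro card_inj_on_le) auto
  thus False using \<open>p \<le> card T\<close> p_gt_1 by simp
qed

text \<open>With \<open>b = Suc t\<close> all splitters are units, the count of level
  \<open>t\<close> makes \<open>card S\<close> divide \<open>p - 1\<close>, and \<open>t > 0\<close>
  gives \<open>m \<le> p ^ t * p ^ t\<close>.\<close>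

lemma card_splitter_prime_power_aux: "card S = 1 \<or> card S = 2 \<and> k1 = 0"
proof (rule coprime_splitter_card)
  have v0: "v s = 0" if "s \<in> S" for s
    using v_S_bound(1)[OF that] exponent_eq_Suc by simp
  show "coprime s m" if "s \<in> S" for s
    using v0[OF that] not_dvd_SV_0[of s] that prime_imp_coprime[OF prime_int_p, of s]
    by (simp add: SV_def m_pp coprime_commute)
  have "SV 0 = S" using v0 by (auto simp: SV_def)
  hence "card (MV t) * card S = p - 1" using level_t_eq(2) exponent_eq_Suc by simp
  hence "card S dvd p - 1" by (metis dvd_triv_right)
  hence "card S \<le> p - 1" using p_gt_1 by (intro dvd_imp_le) auto
  thus "int (card S) \<le> int p - 1" using p_gt_1 by linarith
  have "m \<le> int p ^ t * int p ^ t"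
    unfolding m_pp exponent_eq_Suc power_add[symmetric] using p_gt_1 t_pos by (intro power_increasing) auto
  also have "\<dots> \<le> k2 * k2" using t k2_ge by (intro mult_mono) auto
  also have "\<dots> < (k2 + 1)\<^sup>2" using k2_ge by (simp add: power2_eq_square algebra_simps)
  finally show "m < (k2 + 1)\<^sup>2" .
qed (use p in auto)

end

lemma card_splitter_prime_power: "card S = 1 \<or> card S = 2 \<and> k1 = 0"
proof -
  have "1 \<le> nat k2" "2 \<le> p" using k2_ge p_gt_1 by auto
  then obtain t where "p ^ t \<le> nat k2" "nat k2 < p ^ (t + 1)"
    using ex_power_ivl1 by blast
  hence "int (p ^ t) \<le> int (nat k2)" "int (nat k2) < int (p ^ Suc t)" by (simp_all only: of_nat_le_iff of_nat_less_iff Suc_eq_plus1)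
  hence "int p ^ t \<le> k2" "k2 < int p ^ Suc t" using k2_ge by simp_all
  thus ?thesis by (rule card_splitter_prime_power_aux)
qed

end

end

theorem theorem1p4:
  fixes \<alpha> \<beta> :: nat
    and k1 k2 m p p1 p2 :: int
    and S :: "int set"
  assumes "0 \<le> k1" and "k1 \<le> k2" and "k2 \<ge> 3" and "\<beta> \<ge> 1"
    and "prime p" and "odd p"
    and "prime p1" and "odd p1"
    and "prime p2" and "odd p2"
    and "splits (interval_star (- k1) k2) m S"
    and "purely_singular (interval_star (- k1) k2) m"
    and "m = 2 ^ \<alpha> * p ^ \<beta> \<or> m = 2 ^ \<alpha> * p1 * p2"
  shows "(k1 \<ge> 1 \<longrightarrow> m = k1 + k2 + 1) \<and>
         (k1 = 0 \<longrightarrow> m = k2 + 1 \<or> m = 2 * k2 + 1)"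
proof -
  have prime_ge: "2 < q" if "prime q" "odd q" for q :: int
    using prime_ge_2_int[OF that(1)] that(2) by (cases "q = 2") auto
  have "2 < m"
  proof -
    have "2 < p ^ \<beta>" using prime_ge[OF assms(5,6)] \<open>\<beta> \<ge> 1\<close> self_le_power[of p \<beta>] by simp
    moreover have "2 * 1 < p1 * p2"
      using prime_ge[OF assms(7,8)] prime_ge[OF assms(9,10)] by (intro mult_strict_mono) auto
    moreover have "2 < 2 ^ \<alpha> * w" if "2 < w" for w :: int
    proof -
      have "1 * w \<le> 2 ^ \<alpha> * w" using that by (intro mult_right_mono) auto
      thus ?thesis unfolding mult_1 using that by (rule less_le_trans[rotated])
    qed
    ultimately show ?thesis using assms(13) by (auto simp: mult.assoc)
  qed
  then interpret interval_splitting k1 k2 m "interval_star (- k1) k2" S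
    using assms by (intro interval_splittingI) auto
  have small: "q \<le> k2" if "prime q" "q dvd m" for q
  proof -
    obtain x where x: "x \<in> interval_star (- k1) k2" "q dvd x"
      using assms(12) \<open>prime q\<close> \<open>q dvd m\<close> unfolding purely_singular_def by blast
    have "q \<le> \<bar>x\<bar>" using x dvd_imp_le_int[of x q] by (auto simp: interval_star_def)
    thus ?thesis using x(1) assms by (auto simp: interval_star_def)
  qed
  \<comment> \<open>Equal primes \<open>p1 = p2\<close> are treated as a prime power with exponent
    2, which leaves distinct primes in the product case.\<close>
  define b where "b = (if m = 2 ^ \<alpha> * p ^ \<beta> then \<beta> else 2)"
  define q where "q = (if m = 2 ^ \<alpha> * p ^ \<beta> then p else p1)"
  have q: "prime q" "odd q" "0 < b"
    using assms by (auto simp: q_def b_def)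
  have form: "m = 2 ^ \<alpha> * q ^ b \<or> m = 2 ^ \<alpha> * (p1 * p2) \<and> p1 \<noteq> p2"
    using assms(13) by (auto simp: q_def b_def power2_eq_square)
  have card: "card S = 1 \<or> card S = 2 \<and> k1 = 0"
  proof (cases "\<alpha> = 0")
    case False
    hence "even m" using form by auto
    hence "m = D" using m_eq_D_if_even[OF _ small] q assms form by blast
    hence "int (card S) * (k1 + k2) = 1 * (k1 + k2)" using m_eq by (simp add: D_def)
    hence "int (card S) = 1" using assms by (simp only: mult_cancel_right) auto
    thus ?thesis by simp
  next
    case True
    from form show ?thesis
    proof
      assume m: "m = 2 ^ \<alpha> * q ^ b"
      hence "q dvd m" using q by (simp add: dvd_power)
      moreover have "q = int (nat q)" using q(1) by (simp add: prime_ge_0_int)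
      ultimately show ?thesis
        using card_splitter_prime_power[of "nat q" b] small[of q] q m True
        by (metis even_of_nat mult_1 power_0 prime_nat_int_transfer)
    next
      assume *: "m = 2 ^ \<alpha> * (p1 * p2) \<and> p1 \<noteq> p2"
      hence "p1 \<le> k2" "p2 \<le> k2" using small assms by auto
      thus ?thesis
        using card_splitter_prime_product[of p1 p2] card_splitter_prime_product[of p2 p1] * assms True
        by (cases p1 p2 rule: linorder_cases) (auto simp: mult.commute)
    qed
  qed
  thus ?thesis using m_eq assms by auto
qed

end
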